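(* Let $G$ be a countable infinite discrete group and $\alpha: G\curvearrowright X$ a continuous action on the Cantor set $X$ such that there is no $G$-invariant non-trivial Borel measure on $X$. Then the type semigroup $W(X,G)$ is almost unperforated if and only if $\alpha$ has paradoxical comparison.
   Context: A Borel measure $\mu$ on $X$ (possibly unbounded) is non-trivial if there is a clopen $O\subset X$ with $0<\mu(O)<\infty$. Subequivalence: for closed $F\subset X$ and open $O\subset X$, write $F\prec O$ if there exist a finite collection $\mathcal{U}$ of open sets covering $F$ and elements $s_U\in G$ such that the sets $s_UU$, $U\in\mathcal{U}$, are pairwise disjoint subsets of $O$. Paradoxical comparison: for every nonempty open $O\subset X$ and every closed $F\subset O$ there are disjoint nonempty open $O_1,O_2\subset O$ with $F\prec O_1$ and $F\prec O_2$. Type semigroup: on $C(X,\mathbb{Z}_{\ge0})$ let $f\sim g$ if there are $h_1,\dots,h_n\in C(X,\mathbb{Z}_{\ge0})$ and $s_1,\dots,s_n\in G$ with $\sum_i h_i=f$ and $\sum_i h_i(s_i^{-1}\cdot)=g$; $W(X,G)=C(X,\mathbb{Z}_{\ge0})/\!\sim$ with $[f]+[g]=[f+g]$ and the algebraic preorder ($a\le b$ iff $a+c=b$ for some $c$). $W(X,G)$ is almost unperforated if whenever $x,y\in W(X,G)$, $n\in\mathbb{N}$ and $(n+1)x\le ny$, one has $x\le y$. *)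

theory Defs
  imports "HOL-Analysis.Analysis" "HOL-Algebra.Group_Action"
begin

definition cantor_space :: "(nat \<Rightarrow> bool) topology" where
  "cantor_space = product_topology (\<lambda>_. discrete_topology UNIV) UNIV"

definition continuous_action :: "('g, 'b) monoid_scheme \<Rightarrow> 'a topology \<Rightarrow> ('g \<Rightarrow> 'a \<Rightarrow> 'a) \<Rightarrow> bool" where
  "continuous_action G X act \<longleftrightarrow> group_action G (topspace X) act \<and>
     (\<forall>g \<in> carrier G. continuous_map X X (act g))"

definition borel_measure_on :: "'a topology \<Rightarrow> 'a measure \<Rightarrow> bool" where
  "borel_measure_on X M \<longleftrightarrow> space M = topspace X \<and>
     sets M = sigma_sets (topspace X) {U. openin X U}"

definition nontrivial_measure :: "'a topology \<Rightarrow> 'a measure \<Rightarrow> bool" where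
  "nontrivial_measure X M \<longleftrightarrow>
     (\<exists>W. closedin X W \<and> openin X W \<and> 0 < emeasure M W \<and> emeasure M W < \<infinity>)"

definition invariant_measure :: "('g, 'b) monoid_scheme \<Rightarrow> ('g \<Rightarrow> 'a \<Rightarrow> 'a) \<Rightarrow> 'a measure \<Rightarrow> bool" where
  "invariant_measure G act M \<longleftrightarrow>
     (\<forall>g \<in> carrier G. \<forall>A \<in> sets M. emeasure M (act g ` A) = emeasure M A)"

definition subequiv :: "('g, 'b) monoid_scheme \<Rightarrow> 'a topology \<Rightarrow> ('g \<Rightarrow> 'a \<Rightarrow> 'a) \<Rightarrow> 'a set \<Rightarrow> 'a set \<Rightarrow> bool" where
  "subequiv G X act F W \<longleftrightarrow>
     (\<exists>\<U> s. finite \<U> \<and> (\<forall>U\<in>\<U>. openin X U) \<and> F \<subseteq> \<Union>\<U> \<and>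
        (\<forall>U\<in>\<U>. s U \<in> carrier G \<and> act (s U) ` U \<subseteq> W) \<and>
        (\<forall>U\<in>\<U>. \<forall>V\<in>\<U>. U \<noteq> V \<longrightarrow> act (s U) ` U \<inter> act (s V) ` V = {}))"

definition paradoxical_comparison :: "('g, 'b) monoid_scheme \<Rightarrow> 'a topology \<Rightarrow> ('g \<Rightarrow> 'a \<Rightarrow> 'a) \<Rightarrow> bool" where
  "paradoxical_comparison G X act \<longleftrightarrow>
     (\<forall>W F. openin X W \<and> W \<noteq> {} \<and> closedin X F \<and> F \<subseteq> W \<longrightarrow>
        (\<exists>W1 W2. openin X W1 \<and> openin X W2 \<and> W1 \<noteq> {} \<and> W2 \<noteq> {} \<and>
           W1 \<subseteq> W \<and> W2 \<subseteq> W \<and> W1 \<inter> W2 = {} \<and>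
           subequiv G X act F W1 \<and> subequiv G X act F W2))"

text \<open>C(X, Z_{\<ge>0}): continuous N-valued functions (N discrete).  Functions are
  only compared on the points of X.\<close>
definition cont_nat :: "'a topology \<Rightarrow> ('a \<Rightarrow> nat) \<Rightarrow> bool" where
  "cont_nat X f \<longleftrightarrow> continuous_map X (discrete_topology UNIV) f"

definition type_equiv :: "('g, 'b) monoid_scheme \<Rightarrow> 'a topology \<Rightarrow> ('g \<Rightarrow> 'a \<Rightarrow> 'a) \<Rightarrow> ('a \<Rightarrow> nat) \<Rightarrow> ('a \<Rightarrow> nat) \<Rightarrow> bool" where
  "type_equiv G X act f g \<longleftrightarrow>
     (\<exists>n::nat. \<exists>h s. (\<forall>i<n. cont_nat X (h i) \<and> s i \<in> carrier G) \<and>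
        (\<forall>x\<in>topspace X. (\<Sum>i<n. h i x) = f x) \<and>
        (\<forall>x\<in>topspace X. (\<Sum>i<n. h i (act (inv\<^bsub>G\<^esub> (s i)) x)) = g x))"

text \<open>The algebraic preorder on W(X,G) = C(X,Z_{\<ge>0})/\<sim>, expressed on
  representatives: [f] \<le> [g] iff [f] + [c] = [g] for some c, i.e. f + c \<sim> g.\<close>
definition type_le :: "('g, 'b) monoid_scheme \<Rightarrow> 'a topology \<Rightarrow> ('g \<Rightarrow> 'a \<Rightarrow> 'a) \<Rightarrow> ('a \<Rightarrow> nat) \<Rightarrow> ('a \<Rightarrow> nat) \<Rightarrow> bool" where
  "type_le G X act f g \<longleftrightarrow>
     (\<exists>c. cont_nat X c \<and> type_equiv G X act (\<lambda>x. f x + c x) g)"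

text \<open>W(X,G) almost unperforated: for x=[f], y=[g] and n \<ge> 1,
  (n+1)x \<le> ny implies x \<le> y  (note k[f] = [k f]).\<close>
definition almost_unperforated :: "('g, 'b) monoid_scheme \<Rightarrow> 'a topology \<Rightarrow> ('g \<Rightarrow> 'a \<Rightarrow> 'a) \<Rightarrow> bool" where
  "almost_unperforated G X act \<longleftrightarrow>
     (\<forall>f g (n::nat). cont_nat X f \<and> cont_nat X g \<and> n \<ge> 1 \<and>
        type_le G X act (\<lambda>x. (n + 1) * f x) (\<lambda>x. n * g x) \<longrightarrow> type_le G X act f g)"

end

theory Submission
  imports Defs
begin

text \<open>Paradoxical comparison says that \<open>2[1\<^sub>A] \<le> [1\<^sub>A]\<close> in the type semigroup for every clopen \<open>A\<close>. It implies
  \<open>2x \<le> x\<close> for all \<open>x\<close>, and then \<open>(n + 1)x \<le> ny\<close> gives \<open>x \<le> (n + 1)x \<le> ny \<le> y\<close>. Conversely, by Tarski's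
  theorem, if \<open>(n + 1)[1\<^sub>A] \<le> n[1\<^sub>A]\<close> fails for all \<open>n\<close>, then there is an additive monotone map from the type
  semigroup to \<open>[0, \<infinity>]\<close> taking the value 1 at \<open>[1\<^sub>A]\<close>; by compactness it is a premeasure on the clopen sets,
  and its outer measure restricts to an invariant non-trivial Borel measure. In the absence of such measures
  some \<open>n\<close> works, hence \<open>k[1\<^sub>A] \<le> n[1\<^sub>A]\<close> for all \<open>k\<close>, and almost unperforation yields \<open>2[1\<^sub>A] \<le> [1\<^sub>A]\<close>.
  The additive map is found as a minimal element among the sublinear monotone functionals \<open>q\<close> with
  \<open>q (f + e) = q f + 1\<close>, where \<open>e = 1\<^sub>A\<close>: a minimal \<open>q\<close> agrees with
  \<open>f \<mapsto> inf\<^sub>n (q (f + n h) - n q h)\<close> for every \<open>h\<close>, which forces \<open>q f + q h \<le> q (f + h)\<close>.\<close>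

section \<open>States on preordered cones of functions\<close>

lemma le_Inf_add_Inf:
  fixes A B :: "real set"
  assumes "A \<noteq> {}" "B \<noteq> {}" and le: "\<And>a b. a \<in> A \<Longrightarrow> b \<in> B \<Longrightarrow> c \<le> a + b"
  shows "c \<le> Inf A + Inf B"
proof -
  have "c - b \<le> Inf A" if "b \<in> B" for b
    using that assms(1) le by (intro cInf_greatest) (auto simp: algebra_simps)
  then have "c - Inf A \<le> Inf B"
    using assms(2) by (intro cInf_greatest) (auto simp: algebra_simps)
  then show ?thesis by simp
qed

text \<open>Models the functions whose class lies below a multiple of the class of \<open>e\<close>.
  Functions stand for their classes, so \<open>le\<close> is a preorder; by \<open>le_unit\<close>,
  \<open>e\<close> is an order unit.\<close>

locale preordered_function_cone =
  fixes I :: "('a \<Rightarrow> nat) set" and le :: "('a \<Rightarrow> nat) \<Rightarrow> ('a \<Rightarrow> nat) \<Rightarrow> bool" and e :: "'a \<Rightarrow> nat"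
  assumes zero_in: "(\<lambda>_. 0) \<in> I"
    and add_in: "\<lbrakk>f \<in> I; g \<in> I\<rbrakk> \<Longrightarrow> (\<lambda>x. f x + g x) \<in> I"
    and e_in: "e \<in> I"
    and le_refl: "f \<in> I \<Longrightarrow> le f f"
    and le_trans: "\<lbrakk>f \<in> I; g \<in> I; h \<in> I; le f g; le g h\<rbrakk> \<Longrightarrow> le f h"
    and le_add: "\<lbrakk>f \<in> I; g \<in> I\<rbrakk> \<Longrightarrow> le f (\<lambda>x. f x + g x)"
    and le_add_mono: "\<lbrakk>f \<in> I; g \<in> I; h \<in> I; le f g\<rbrakk> \<Longrightarrow> le (\<lambda>x. f x + h x) (\<lambda>x. g x + h x)"
    and le_unit: "f \<in> I \<Longrightarrow> \<exists>m::nat. le f (\<lambda>x. m * e x)"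
    and e_not_paradoxical: "\<not> le (\<lambda>x. (n + 1) * e x) (\<lambda>x. n * e x)"
begin

lemma scale_in: "f \<in> I \<Longrightarrow> (\<lambda>x. k * f x) \<in> I" for k :: nat
proof (induction k)
  case (Suc k)
  then show ?case using add_in[of f "\<lambda>x. k * f x"] by simp
qed (simp add: zero_in)

lemma le_add_mono2:
  assumes "f \<in> I" "g \<in> I" "f' \<in> I" "g' \<in> I" "le f g" "le f' g'"
  shows "le (\<lambda>x. f x + f' x) (\<lambda>x. g x + g' x)"
proof (rule le_trans)
  show "le (\<lambda>x. f x + f' x) (\<lambda>x. g x + f' x)" using assms by (intro le_add_mono)
  show "le (\<lambda>x. g x + f' x) (\<lambda>x. g x + g' x)"
    using le_add_mono[of f' g' g] assms by (simp add: add.commute)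
qed (use assms in \<open>auto intro: add_in\<close>)

lemma le_scale_mono: "\<lbrakk>f \<in> I; g \<in> I; le f g\<rbrakk> \<Longrightarrow> le (\<lambda>x. k * f x) (\<lambda>x. k * g x)" for k :: nat
proof (induction k)
  case (Suc k)
  then show ?case using le_add_mono2[of f g "\<lambda>x. k * f x" "\<lambda>x. k * g x"] by (simp add: scale_in)
qed (simp add: le_refl zero_in)

text \<open>If \<open>l > m\<close>, then \<open>(m + 1) e \<le> l e \<le> m e\<close>, against
  \<open>e_not_paradoxical\<close>. This is what makes all \<open>upper_ratios\<close>
  nonnegative.\<close>

lemma le_scale_unit:
  assumes "le (\<lambda>x. l * e x) (\<lambda>x. m * e x)" shows "l \<le> (m::nat)"
proof (rule ccontr)
  assume "\<not> l \<le> m"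
  then have "le (\<lambda>x. (m + 1) * e x) (\<lambda>x. l * e x)"
    using le_add[OF scale_in[OF e_in, of "m + 1"] scale_in[OF e_in, of "l - (m + 1)"]]
    unfolding add_mult_distrib[symmetric] by simp
  then show False
    using e_not_paradoxical assms le_trans scale_in e_in by blast
qed

text \<open>The shift by \<open>l * e\<close> on both sides makes up for the lack of cancellation: without it the infimum
  of \<open>upper_ratios\<close> need not be additive in the direction of \<open>e\<close>.\<close>

definition upper_ratios :: "('a \<Rightarrow> nat) \<Rightarrow> real set" where
  "upper_ratios f = {(real m - real l) / real k | k l m.
     k \<ge> 1 \<and> le (\<lambda>x. k * f x + l * e x) (\<lambda>x. m * e x)}"

text \<open>For \<open>k \<ge> 1\<close>, subadditivity already gives
  \<open>q (k f) \<le> k * q f\<close>; the opposite inequality is imposed so that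
  \<open>lowered\<close> stays nonnegative. Additivity in the direction of \<open>e\<close> carries
  the normalisation \<open>q e = 1\<close>. The value 0 outside \<open>I\<close> makes
  \<open>q\<close> determined by its restriction to \<open>I\<close>.\<close>

definition sublinear_states :: "(('a \<Rightarrow> nat) \<Rightarrow> real) set" where
  "sublinear_states = {q.
     (\<forall>f. 0 \<le> q f) \<and> (\<forall>f. f \<notin> I \<longrightarrow> q f = 0) \<and>
     (\<forall>f\<in>I. \<forall>g\<in>I. le f g \<longrightarrow> q f \<le> q g) \<and>
     (\<forall>f\<in>I. \<forall>g\<in>I. q (\<lambda>x. f x + g x) \<le> q f + q g) \<and>
     (\<forall>f\<in>I. \<forall>k::nat. k * q f \<le> q (\<lambda>x. k * f x)) \<and>
     (\<forall>f\<in>I. q (\<lambda>x. f x + e x) = q f + 1)}"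

lemma upper_ratiosI:
  "\<lbrakk>k \<ge> 1; le (\<lambda>x. k * f x + l * e x) (\<lambda>x. m * e x)\<rbrakk> \<Longrightarrow> (real m - real l) / real k \<in> upper_ratios f"
  by (auto simp: upper_ratios_def)

lemma upper_ratios_nonneg:
  assumes "f \<in> I" "a \<in> upper_ratios f" shows "0 \<le> a"
proof -
  obtain k l m where a: "a = (real m - real l) / real k" "k \<ge> 1"
     "le (\<lambda>x. k * f x + l * e x) (\<lambda>x. m * e x)" using assms(2) by (auto simp: upper_ratios_def)
  have "le (\<lambda>x. l * e x) (\<lambda>x. k * f x + l * e x)"
    using le_add[of "\<lambda>x. l * e x" "\<lambda>x. k * f x"] assms(1) by (simp add: scale_in e_in add.commute)
  then have "le (\<lambda>x. l * e x) (\<lambda>x. m * e x)"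
    using le_trans[OF _ _ _ _ a(3), of "\<lambda>x. l * e x"] assms(1) by (simp add: scale_in e_in add_in)
  then show ?thesis using le_scale_unit a by force
qed

lemma upper_ratios_nonempty: "f \<in> I \<Longrightarrow> upper_ratios f \<noteq> {}"
  using le_unit[of f] upper_ratiosI[of 1 f 0] by fastforce

lemma bdd_upper_ratios: "f \<in> I \<Longrightarrow> bdd_below (upper_ratios f)"
  using upper_ratios_nonneg by (meson bdd_belowI)

text \<open>Provides the functional that Zorn's lemma needs for the empty chain. Each law is checked
  by turning a witness \<open>(k, l, m)\<close> for one function into a witness for another and
  passing to infima.\<close>

lemma Inf_upper_ratios_state: "(\<lambda>f. if f \<in> I then Inf (upper_ratios f) else 0) \<in> sublinear_states"
proof -
  have nonneg: "0 \<le> Inf (upper_ratios f)" if "f \<in> I" for f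
    using that upper_ratios_nonneg upper_ratios_nonempty by (intro cInf_greatest) auto
  have mono: "Inf (upper_ratios f) \<le> Inf (upper_ratios g)" if "f \<in> I" "g \<in> I" "le f g" for f g
  proof (rule cInf_mono)
    fix b assume "b \<in> upper_ratios g"
    then obtain k l m where b: "b = (real m - real l) / real k" "k \<ge> 1"
     "le (\<lambda>x. k * g x + l * e x) (\<lambda>x. m * e x)" by (auto simp: upper_ratios_def)
    have "le (\<lambda>x. k * f x + l * e x) (\<lambda>x. k * g x + l * e x)"
      using that by (intro le_add_mono le_scale_mono) (auto simp: scale_in e_in)
    then have "le (\<lambda>x. k * f x + l * e x) (\<lambda>x. m * e x)"
      by (rule le_trans[OF _ _ _ _ b(3), rotated 3]) (use that in \<open>auto simp: scale_in e_in add_in\<close>)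
    then show "\<exists>a\<in>upper_ratios f. a \<le> b" using upper_ratiosI b by blast
  qed (use that upper_ratios_nonempty bdd_upper_ratios in auto)
  have sub: "Inf (upper_ratios (\<lambda>x. f x + g x)) \<le> Inf (upper_ratios f) + Inf (upper_ratios g)"
    if "f \<in> I" "g \<in> I" for f g
  proof (rule le_Inf_add_Inf)
    fix a b assume "a \<in> upper_ratios f" "b \<in> upper_ratios g"
    then obtain k l m k' l' m' where a: "a = (real m - real l) / real k" "k \<ge> 1"
     "le (\<lambda>x. k * f x + l * e x) (\<lambda>x. m * e x)" and b: "b = (real m' - real l') / real k'" "k' \<ge> 1"
     "le (\<lambda>x. k' * g x + l' * e x) (\<lambda>x. m' * e x)" by (auto simp: upper_ratios_def)
    \<comment> \<open>The two fractions are brought to the common denominator \<open>k * k'\<close>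
      and added.\<close>
    have "le (\<lambda>x. k' * (k * f x + l * e x) + k * (k' * g x + l' * e x)) (\<lambda>x. k' * (m * e x) + k * (m' * e x))"
      by (intro le_add_mono2 le_scale_mono a b) (use that in \<open>auto intro!: scale_in add_in simp: e_in\<close>)
    then have "le (\<lambda>x. (k * k') * (f x + g x) + (k' * l + k * l') * e x) (\<lambda>x. (k' * m + k * m') * e x)"
      by (simp add: algebra_simps)
    from upper_ratiosI[OF _ this] a(2) b(2)
    have "(real (k' * m + k * m') - real (k' * l + k * l')) / real (k * k') \<in> upper_ratios (\<lambda>x. f x + g x)"
      by simp
    moreover have "(real (k' * m + k * m') - real (k' * l + k * l')) / real (k * k') = a + b"
    proof -
      have "real k > 0" "real k' > 0" using a(2) b(2) by auto
      then show ?thesis unfolding a(1) b(1) by (simp add: field_simps)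
    qed
    ultimately show "Inf (upper_ratios (\<lambda>x. f x + g x)) \<le> a + b"
      using bdd_upper_ratios[OF add_in[OF that]] by (metis cInf_lower)
  qed (use that upper_ratios_nonempty in auto)
  have hom: "real k * Inf (upper_ratios f) \<le> Inf (upper_ratios (\<lambda>x. k * f x))" if "f \<in> I" for f k
  proof (cases "k = 0")
    case False
    show ?thesis
    proof (rule cInf_greatest)
      fix a assume "a \<in> upper_ratios (\<lambda>x. k * f x)"
      then obtain j l m where a: "a = (real m - real l) / real j" "j \<ge> 1"
        "le (\<lambda>x. j * (k * f x) + l * e x) (\<lambda>x. m * e x)" by (auto simp: upper_ratios_def)
      then have "(real m - real l) / real (j * k) \<in> upper_ratios f"
        using False by (intro upper_ratiosI) (auto simp: mult.assoc)
      then have "Inf (upper_ratios f) \<le> (real m - real l) / real (j * k)"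
        using that bdd_upper_ratios cInf_lower by blast
      then have "real k * Inf (upper_ratios f) \<le> real k * ((real m - real l) / real (j * k))"
        by (intro mult_left_mono) auto
      also have "\<dots> = a" using a(1) False by simp
      finally show "real k * Inf (upper_ratios f) \<le> a" .
    qed (use that scale_in upper_ratios_nonempty in auto)
  qed (use that zero_in nonneg in auto)
  have unit: "Inf (upper_ratios (\<lambda>x. f x + e x)) = Inf (upper_ratios f) + 1" if "f \<in> I" for f
  proof (rule antisym)
    have fe: "(\<lambda>x. f x + e x) \<in> I" using that add_in e_in by blast
    have "Inf (upper_ratios (\<lambda>x. f x + e x)) - 1 \<le> Inf (upper_ratios f)"
    proof (rule cInf_greatest)
      fix a assume "a \<in> upper_ratios f"
      then obtain k l m where a: "a = (real m - real l) / real k" "k \<ge> 1"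
        "le (\<lambda>x. k * f x + l * e x) (\<lambda>x. m * e x)" by (auto simp: upper_ratios_def)
      have "le (\<lambda>x. k * f x + l * e x + k * e x) (\<lambda>x. m * e x + k * e x)"
        by (intro le_add_mono a) (use that in \<open>auto intro!: scale_in add_in simp: e_in\<close>)
      then have "le (\<lambda>x. k * (f x + e x) + l * e x) (\<lambda>x. (m + k) * e x)"
        by (simp add: algebra_simps)
      then have "Inf (upper_ratios (\<lambda>x. f x + e x)) \<le> (real (m + k) - real l) / real k"
        using a(2) by (intro cInf_lower upper_ratiosI bdd_upper_ratios fe)
      also have "\<dots> = a + 1" using a by (simp add: field_simps)
      finally show "Inf (upper_ratios (\<lambda>x. f x + e x)) - 1 \<le> a" by simp
    qed (use that upper_ratios_nonempty in auto)
    then show "Inf (upper_ratios (\<lambda>x. f x + e x)) \<le> Inf (upper_ratios f) + 1" by simp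
    show "Inf (upper_ratios f) + 1 \<le> Inf (upper_ratios (\<lambda>x. f x + e x))"
    proof (rule cInf_greatest)
      fix a assume "a \<in> upper_ratios (\<lambda>x. f x + e x)"
      then obtain k l m where a: "a = (real m - real l) / real k" "k \<ge> 1"
        "le (\<lambda>x. k * (f x + e x) + l * e x) (\<lambda>x. m * e x)" by (auto simp: upper_ratios_def)
      \<comment> \<open>The term \<open>k * e\<close> is absorbed into the shift, which becomes
        \<open>k + l\<close>; this lowers the ratio by exactly 1.\<close>
      then have "le (\<lambda>x. k * f x + (k + l) * e x) (\<lambda>x. m * e x)"
        by (simp add: algebra_simps)
      then have "Inf (upper_ratios f) \<le> (real m - real (k + l)) / real k"
        using a(2) that by (intro cInf_lower upper_ratiosI bdd_upper_ratios)
      also have "\<dots> = a - 1" using a by (simp add: field_simps)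
      finally show "Inf (upper_ratios f) + 1 \<le> a" by simp
    qed (use fe upper_ratios_nonempty in auto)
  qed
  show ?thesis
    unfolding sublinear_states_def
    by (auto simp: nonneg mono sub hom unit add_in scale_in e_in)
qed

lemma Inf_chain_state:
  assumes "C \<noteq> {}" and sub: "C \<subseteq> sublinear_states"
    and chain: "\<And>q q'. q \<in> C \<Longrightarrow> q' \<in> C \<Longrightarrow> (\<forall>f. q f \<le> q' f) \<or> (\<forall>f. q' f \<le> q f)"
  shows "(\<lambda>f. INF q\<in>C. q f) \<in> sublinear_states"
proof -
  have bdd: "bdd_below ((\<lambda>q. q f) ` C)" for f
    using sub by (intro bdd_belowI[of _ 0]) (auto simp: sublinear_states_def)
  have low: "(INF q\<in>C. q f) \<le> q f" if "q \<in> C" for q f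
    using bdd that by (rule cINF_lower)
  have S: "q \<in> sublinear_states" if "q \<in> C" for q using sub that by auto
  have "0 \<le> (INF q\<in>C. q f)" for f
    using assms(1) S by (intro cINF_greatest) (auto simp: sublinear_states_def)
  moreover have "(INF q\<in>C. q f) = 0" if "f \<notin> I" for f
  proof -
    have "(\<lambda>q. q f) ` C = {0}" using assms(1) S that by (force simp: sublinear_states_def)
    then show ?thesis by simp
  qed
  moreover have "(INF q\<in>C. q f) \<le> (INF q\<in>C. q g)" if "f \<in> I" "g \<in> I" "le f g" for f g
    using assms(1) S that
    by (intro cINF_greatest order.trans[OF low]) (auto simp: sublinear_states_def)
  moreover have "(INF q\<in>C. q (\<lambda>x. f x + g x)) \<le> (INF q\<in>C. q f) + (INF q\<in>C. q g)"
    if fg: "f \<in> I" "g \<in> I" for f g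
  proof (rule le_Inf_add_Inf)
    fix a b assume "a \<in> (\<lambda>q. q f) ` C" "b \<in> (\<lambda>q. q g) ` C"
    then obtain q q' where q: "q \<in> C" "a = q f" "q' \<in> C" "b = q' g" by auto
    have *: "r (\<lambda>x. f x + g x) \<le> r f + r g" if "r \<in> C" for r
      using S[OF that] fg by (auto simp: sublinear_states_def)
    \<comment> \<open>The smaller of \<open>q\<close> and \<open>q'\<close> serves for both
      \<open>f\<close> and \<open>g\<close>; this is where the chain property enters.\<close>
    from chain[OF q(1) q(3)] show "(INF q\<in>C. q (\<lambda>x. f x + g x)) \<le> a + b"
    proof
      assume "\<forall>f. q f \<le> q' f"
      then have "q g \<le> q' g" by simp
      then show ?thesis
        using low[OF q(1), of "\<lambda>x. f x + g x"] *[OF q(1)] unfolding q by linarith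
    next
      assume "\<forall>f. q' f \<le> q f"
      then have "q' f \<le> q f" by simp
      then show ?thesis
        using low[OF q(3), of "\<lambda>x. f x + g x"] *[OF q(3)] unfolding q by linarith
    qed
  qed (use assms(1) in auto)
  moreover have "real k * (INF q\<in>C. q f) \<le> (INF q\<in>C. q (\<lambda>x. k * f x))" if "f \<in> I" for f k
  proof (rule cINF_greatest)
    fix q assume q: "q \<in> C"
    have "real k * (INF q\<in>C. q f) \<le> real k * q f"
      using low[OF q] by (intro mult_left_mono) auto
    also have "\<dots> \<le> q (\<lambda>x. k * f x)" using S[OF q] that by (auto simp: sublinear_states_def)
    finally show "real k * (INF q\<in>C. q f) \<le> q (\<lambda>x. k * f x)" .
  qed (use assms(1) in auto)
  moreover have "(INF q\<in>C. q (\<lambda>x. f x + e x)) = (INF q\<in>C. q f) + 1" if "f \<in> I" for f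
  proof -
    have eq: "q (\<lambda>x. f x + e x) = q f + 1" if "q \<in> C" for q
      using S[OF that] \<open>f \<in> I\<close> by (auto simp: sublinear_states_def)
    have "(INF q\<in>C. q (\<lambda>x. f x + e x)) - 1 \<le> (INF q\<in>C. q f)"
    proof (rule cINF_greatest)
      fix q assume "q \<in> C"
      then show "(INF q\<in>C. q (\<lambda>x. f x + e x)) - 1 \<le> q f"
        using low[of q "\<lambda>x. f x + e x"] eq[of q] by linarith
    qed fact
    moreover have "(INF q\<in>C. q f) + 1 \<le> (INF q\<in>C. q (\<lambda>x. f x + e x))"
    proof (rule cINF_greatest)
      fix q assume "q \<in> C"
      then show "(INF q\<in>C. q f) + 1 \<le> q (\<lambda>x. f x + e x)" using low[of q f] eq[of q] by linarith
    qed fact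
    ultimately show ?thesis by simp
  qed
  ultimately show ?thesis unfolding sublinear_states_def by blast
qed

section \<open>Lowering a sublinear functional in one direction\<close>

context
  fixes q h assumes q: "q \<in> sublinear_states" and h: "h \<in> I"
begin

text \<open>The marginal value of \<open>f\<close> on top of many copies of \<open>h\<close>. As in
  the proof of the Hahn-Banach theorem, \<open>q\<close> is lowered along \<open>h\<close>, but
  without subtracting functions.\<close>

definition lowered :: "('a \<Rightarrow> nat) \<Rightarrow> real" where
  "lowered f = (if f \<in> I then INF n::nat. q (\<lambda>x. f x + n * h x) - n * q h else 0)"

text \<open>The terms \<open>q (f + n h) - n q h\<close> are nonnegative because
  \<open>n q h \<le> q (n h)\<close>, and by subadditivity they do not increase with
  \<open>n\<close>. Hence the infimum is a limit and inherits the laws of \<open>q\<close>. The last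
  inequality is the term \<open>n = 1\<close>.\<close>

lemma lowered_state: "lowered \<in> sublinear_states" and lowered_le: "lowered f \<le> q f"
  and lowered_additive_le: "f \<in> I \<Longrightarrow> lowered f \<le> q (\<lambda>x. f x + h x) - q h"
proof -
  let ?a = "\<lambda>f (n::nat). q (\<lambda>x. f x + n * h x) - n * q h"
  have q0: "0 \<le> q f" "f \<notin> I \<Longrightarrow> q f = 0" for f using q by (auto simp: sublinear_states_def)
  have qm: "q f \<le> q g" if "f \<in> I" "g \<in> I" "le f g" for f g
    using that q by (auto simp: sublinear_states_def)
  have qs: "q (\<lambda>x. f x + g x) \<le> q f + q g" if "f \<in> I" "g \<in> I" for f g
    using that q by (auto simp: sublinear_states_def)
  have qh: "real k * q f \<le> q (\<lambda>x. k * f x)" if "f \<in> I" for f k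
    using that q by (auto simp: sublinear_states_def)
  have qe: "q (\<lambda>x. f x + e x) = q f + 1" if "f \<in> I" for f
    using that q by (auto simp: sublinear_states_def)
  have qz: "q (\<lambda>_. 0) = 0" using qh[OF zero_in, of 2] q0(1)[of "\<lambda>_. 0"] by simp
  have qk: "q (\<lambda>x. k * f x) \<le> k * q f" if "f \<in> I" for f and k :: nat
  proof (induction k)
    case (Suc k)
    then show ?case using qs[OF that scale_in[OF that, of k]] by (simp add: algebra_simps)
  qed (simp add: qz)
  have in': "(\<lambda>x. f x + n * h x) \<in> I" if "f \<in> I" for f n using that h by (intro add_in scale_in)
  have nonneg: "0 \<le> ?a f n" if "f \<in> I" for f n
  proof -
    have "real n * q h \<le> q (\<lambda>x. n * h x)" using qh h by blast
    also have "\<dots> \<le> q (\<lambda>x. f x + n * h x)"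
      using le_add[of "\<lambda>x. n * h x" f] that h by (intro qm in' scale_in) (simp_all add: scale_in add.commute)
    finally show ?thesis by simp
  qed
  have bdd: "bdd_below (range (?a f))" if "f \<in> I" for f
    using nonneg[OF that] by (intro bdd_belowI[of _ 0]) auto
  have low: "lowered f \<le> ?a f n" if "f \<in> I" for f n
    unfolding lowered_def using that bdd by (auto intro: cINF_lower)
  have lowI: "c \<le> lowered f" if "f \<in> I" "\<And>n. c \<le> ?a f n" for c f
    unfolding lowered_def using that by (auto intro: cINF_greatest)
  show "lowered f \<le> q f" for f using low[of f 0] q0[of f] by (cases "f \<in> I") (auto simp: lowered_def)
  show "f \<in> I \<Longrightarrow> lowered f \<le> q (\<lambda>x. f x + h x) - q h" for f using low[of f 1] by simp
  have decr: "?a f (n + m) \<le> ?a f n" if "f \<in> I" for f n m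
  proof -
    have "q (\<lambda>x. f x + (n + m) * h x) \<le> q (\<lambda>x. f x + n * h x) + q (\<lambda>x. m * h x)"
      using qs[OF in'[OF that, of n] scale_in[OF h, of m]] by (simp add: algebra_simps)
    then show ?thesis using qk[OF h, of m] by (simp add: algebra_simps)
  qed
  have "0 \<le> lowered f" for f
  proof (cases "f \<in> I")
    case True
    then show ?thesis by (intro lowI nonneg)
  qed (simp add: lowered_def)
  moreover have "lowered f = 0" if "f \<notin> I" for f using that by (simp add: lowered_def)
  moreover have "lowered f \<le> lowered g" if "f \<in> I" "g \<in> I" "le f g" for f g
  proof (rule lowI)
    fix n
    have "lowered f \<le> ?a f n" using low that by blast
    also have "\<dots> \<le> ?a g n" using that h by (auto intro!: qm in' le_add_mono scale_in)
    finally show "lowered f \<le> ?a g n" .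
  qed fact
  moreover have "lowered (\<lambda>x. f x + g x) \<le> lowered f + lowered g" if "f \<in> I" "g \<in> I" for f g
  proof -
    have "lowered (\<lambda>x. f x + g x) \<le> Inf (range (?a f)) + Inf (range (?a g))"
    proof (rule le_Inf_add_Inf)
      fix a b assume "a \<in> range (?a f)" "b \<in> range (?a g)"
      then obtain n m where ab: "a = ?a f n" "b = ?a g m" by auto
      have "lowered (\<lambda>x. f x + g x) \<le> ?a (\<lambda>x. f x + g x) (n + m)"
        using low[OF add_in[OF that], of "n + m"] .
      also have "\<dots> \<le> ?a f n + ?a g m"
        using qs[OF in'[OF that(1), of n] in'[OF that(2), of m]] by (simp add: algebra_simps)
      finally show "lowered (\<lambda>x. f x + g x) \<le> a + b" by (simp add: ab)
    qed auto
    then show ?thesis using that by (simp add: lowered_def)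
  qed
  moreover have "real k * lowered f \<le> lowered (\<lambda>x. k * f x)" if "f \<in> I" for f k
  proof (cases "k = 0")
    case True
    then show ?thesis using lowI[OF zero_in] nonneg[OF zero_in] by simp
  next
    case False
    show ?thesis
    proof (rule lowI)
      fix n
      have "real k * lowered f \<le> k * ?a f n" using low[OF that] by (intro mult_left_mono) auto
      also have "\<dots> \<le> ?a (\<lambda>x. k * f x) (k * n)"
        using qh[OF in'[OF that, of n], of k] by (simp add: algebra_simps)
      \<comment> \<open>Since \<open>k \<ge> 1\<close>, the index \<open>k * n\<close> is at least
        \<open>n\<close>, so \<open>decr\<close> applies.\<close>
      also have "k * n = n + (k * n - n)" using False by simp
      also have "?a (\<lambda>x. k * f x) (n + (k * n - n)) \<le> ?a (\<lambda>x. k * f x) n"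
        by (intro decr scale_in that)
      finally show "real k * lowered f \<le> ?a (\<lambda>x. k * f x) n" .
    qed (use that scale_in in auto)
  qed
  moreover have "lowered (\<lambda>x. f x + e x) = lowered f + 1" if "f \<in> I" for f
  proof -
    have *: "?a (\<lambda>x. f x + e x) n = ?a f n + 1" for n
      using qe[OF in'[OF that, of n]] by (simp add: algebra_simps)
    have fe: "(\<lambda>x. f x + e x) \<in> I" using that e_in add_in by blast
    have "lowered (\<lambda>x. f x + e x) - 1 \<le> lowered f"
      using low[OF fe] unfolding * by (intro lowI that) (simp add: algebra_simps)
    moreover have "lowered f + 1 \<le> lowered (\<lambda>x. f x + e x)"
      using low[OF that] by (intro lowI fe) (simp add: *)
    ultimately show ?thesis by simp
  qed
  ultimately show "lowered \<in> sublinear_states" unfolding sublinear_states_def by blast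
qed

end

lemma state_exists:
  obtains \<nu> :: "('a \<Rightarrow> nat) \<Rightarrow> real"
  where "\<And>f. 0 \<le> \<nu> f" "\<nu> e = 1"
    and "\<And>f g. \<lbrakk>f \<in> I; g \<in> I\<rbrakk> \<Longrightarrow> \<nu> (\<lambda>x. f x + g x) = \<nu> f + \<nu> g"
    and "\<And>f g. \<lbrakk>f \<in> I; g \<in> I; le f g\<rbrakk> \<Longrightarrow> \<nu> f \<le> \<nu> g"
proof -
  \<comment> \<open>The order is reversed, so that a maximal element in Zorn's lemma is a minimal
    functional.\<close>
  let ?P = "\<lambda>q q' :: ('a \<Rightarrow> nat) \<Rightarrow> real. \<forall>f. q' f \<le> q f"
  have "\<exists>q\<in>sublinear_states. \<forall>q'\<in>sublinear_states. ?P q q' \<longrightarrow> q' = q"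
  proof (rule predicate_Zorn)
    show "partial_order_on sublinear_states (relation_of ?P sublinear_states)"
      by (rule partial_order_on_relation_ofI) (auto intro: order.trans simp: fun_eq_iff order_antisym)
    fix C assume C: "C \<in> Chains (relation_of ?P sublinear_states)"
    show "\<exists>u\<in>sublinear_states. \<forall>a\<in>C. ?P a u"
    proof (cases "C = {}")
      case True
      then show ?thesis using Inf_upper_ratios_state by auto
    next
      case False
      have sub: "C \<subseteq> sublinear_states"
        using C by (auto simp: Chains_def relation_of_def)
      have "(\<lambda>f. INF q\<in>C. q f) \<in> sublinear_states"
        using C by (intro Inf_chain_state[OF False sub]) (auto simp: Chains_def relation_of_def)
      moreover have "(INF q\<in>C. q f) \<le> a f" if "a \<in> C" for a f
        using sub that by (intro cINF_lower bdd_belowI[of _ 0]) (auto simp: sublinear_states_def)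
      ultimately show ?thesis by (intro bexI[of _ "\<lambda>f. INF q\<in>C. q f"]) auto
    qed
  qed
  then obtain q where q: "q \<in> sublinear_states"
    and minimal: "\<And>q'. q' \<in> sublinear_states \<Longrightarrow> \<forall>f. q' f \<le> q f \<Longrightarrow> q' = q" by blast
  have add: "q (\<lambda>x. f x + g x) = q f + q g" if "f \<in> I" "g \<in> I" for f g
  proof (rule antisym)
    show "q (\<lambda>x. f x + g x) \<le> q f + q g" using q that by (auto simp: sublinear_states_def)
    \<comment> \<open>By minimality \<open>q\<close> equals its own lowering along \<open>g\<close>,
      and the bound by the term \<open>n = 1\<close> becomes superadditivity.\<close>
    have "lowered q g = q"
      using q that by (intro minimal lowered_state allI lowered_le)
    then show "q f + q g \<le> q (\<lambda>x. f x + g x)"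
      using lowered_additive_le[OF q that(2,1)] by simp
  qed
  have "q (\<lambda>_. 0) = 0" using add[OF zero_in zero_in] by simp
  moreover have "q (\<lambda>x. 0 + e x) = q (\<lambda>_. 0) + 1"
    using q zero_in by (auto simp: sublinear_states_def)
  ultimately have "q e = 1" by simp
  with q add that[of q] show ?thesis by (auto simp: sublinear_states_def)
qed

end

section \<open>Clopen bases\<close>

definition clopen_base :: "'a topology \<Rightarrow> 'a set set \<Rightarrow> bool" where
  "clopen_base X \<B> \<longleftrightarrow> (\<forall>B\<in>\<B>. openin X B \<and> closedin X B) \<and>
     (\<forall>U x. openin X U \<longrightarrow> x \<in> U \<longrightarrow> (\<exists>B\<in>\<B>. x \<in> B \<and> B \<subseteq> U))"

text \<open>The base consists of the cylinders over finite words. A basic open set of the product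
  restricts finitely many coordinates, so it contains the cylinder over a long enough prefix of each
  of its points.\<close>

lemma cantor_space_clopen_base: "\<exists>\<B>. countable \<B> \<and> clopen_base cantor_space \<B>"
proof (intro exI conjI)
  define cyl :: "bool list \<Rightarrow> (nat \<Rightarrow> bool) set" where "cyl l = {y. \<forall>i<length l. y i = l ! i}" for l
  let ?X = "cantor_space"
  have top: "topspace ?X = UNIV" by (simp add: cantor_space_def)
  show "countable (range cyl)" by simp
  have coord: "openin ?X {y. y i = b} \<and> closedin ?X {y. y i = b}" for i b
  proof -
    have "continuous_map ?X (discrete_topology UNIV) (\<lambda>y. y i)"
      unfolding cantor_space_def by (rule continuous_map_product_projection) simp
    from openin_continuous_map_preimage[OF this, of "{b}"] closedin_continuous_map_preimage[OF this, of "{b}"]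
    show ?thesis by (simp add: top)
  qed
  have cyl_eq: "cyl l = topspace ?X \<inter> (\<Inter>i\<in>{..<length l}. {y. y i = l ! i})" for l
    by (auto simp: cyl_def top)
  have "openin ?X (cyl l)" for l
    unfolding cyl_eq using coord by (cases "l = []") (auto simp: top intro!: openin_Int openin_INT openin_topspace[of ?X, unfolded top])
  moreover have "closedin ?X (cyl l)" for l
    unfolding cyl_eq using coord by (cases "l = []") (auto simp: top intro!: closedin_Int closedin_INT closedin_topspace[of ?X, unfolded top])
  moreover have "\<exists>B\<in>range cyl. x \<in> B \<and> B \<subseteq> U" if U: "openin ?X U" "x \<in> U" for U x
  proof -
    obtain V where V: "finite {i. V i \<noteq> UNIV}" "x \<in> Pi\<^sub>E UNIV V" "Pi\<^sub>E UNIV V \<subseteq> U"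
      using U unfolding cantor_space_def openin_product_topology_alt by auto
    obtain n where n: "{i. V i \<noteq> UNIV} \<subseteq> {..<n}"
      using V(1) finite_nat_iff_bounded by blast
    have "cyl (map x [0..<n]) \<subseteq> U"
    proof
      fix y assume "y \<in> cyl (map x [0..<n])"
      then have "y i = x i" if "i < n" for i using that by (auto simp: cyl_def)
      then have "y i \<in> V i" for i using n V(2) by (cases "i < n") (auto simp: PiE_iff)
      then show "y \<in> U" using V(3) by (auto simp: PiE_iff)
    qed
    moreover have "x \<in> cyl (map x [0..<n])" by (auto simp: cyl_def)
    ultimately show ?thesis by blast
  qed
  ultimately show "clopen_base ?X (range cyl)" by (auto simp: clopen_base_def)
qed

lemma homeomorphic_clopen_base:
  assumes "X homeomorphic_space Y" "countable \<B>" "clopen_base Y \<B>"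
  shows "\<exists>\<C>. countable \<C> \<and> clopen_base X \<C>"
proof -
  obtain f g where fg: "homeomorphic_maps Y X f g"
    using assms(1) homeomorphic_space_sym unfolding homeomorphic_space_def by blast
  then have f: "homeomorphic_map Y X f" by (simp add: homeomorphic_maps_map)
  have "clopen_base X ((`) f ` \<B>)"
    unfolding clopen_base_def
  proof (intro conjI allI impI ballI)
    fix C assume "C \<in> (`) f ` \<B>"
    then obtain B where B: "B \<in> \<B>" "C = f ` B" by auto
    then have "openin Y B" "closedin Y B" using assms(3) by (auto simp: clopen_base_def)
    then show "openin X C" "closedin X C"
      using homeomorphic_map_openness[OF f] homeomorphic_map_closedness[OF f] B(2)
        openin_subset[of Y B]
      by auto
  next
    fix U x assume U: "openin X U" "x \<in> U"
    have x: "x \<in> topspace X" using U openin_subset by blast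
    have gf: "f (g x) = x" "g x \<in> topspace Y"
      using fg x by (auto simp: homeomorphic_maps_def continuous_map_def)
    have "openin Y {y \<in> topspace Y. f y \<in> U}"
      using f U(1) homeomorphic_imp_continuous_map openin_continuous_map_preimage by blast
    then obtain B where "B \<in> \<B>" "g x \<in> B" "B \<subseteq> {y \<in> topspace Y. f y \<in> U}"
      using assms(3) gf U unfolding clopen_base_def by (metis (mono_tags, lifting) mem_Collect_eq)
    then show "\<exists>C\<in>(`) f ` \<B>. x \<in> C \<and> C \<subseteq> U" using gf by (force intro!: bexI[of _ B])
  qed
  with assms(2) show ?thesis by blast
qed

lemma compact_cantor_space: "compact_space cantor_space"
  by (simp add: cantor_space_def compact_space_product_topology compact_space_discrete_topology)

section \<open>The type semigroup\<close>

text \<open>The entry \<open>(i, j)\<close> is the length of the intersection of the \<open>i\<close>-th block of the interval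
  \<open>[0, \<Sum>a)\<close> cut according to \<open>a\<close> with the \<open>j\<close>-th block of the same interval cut according to \<open>b\<close>.\<close>

definition overlap :: "(nat \<Rightarrow> nat) \<Rightarrow> (nat \<Rightarrow> nat) \<Rightarrow> nat \<Rightarrow> nat \<Rightarrow> nat" where
  "overlap a b i j =
     min (sum a {..<Suc i}) (sum b {..<Suc j}) - max (sum a {..<i}) (sum b {..<j})"

lemma overlap_commute: "overlap a b i j = overlap b a j i"
  by (simp add: overlap_def min.commute max.commute)

lemma sum_overlap:
  assumes "i < n" "sum a {..<n} = sum b {..<m}"
  shows "(\<Sum>j<m. overlap a b i j) = a i"
proof -
  let ?A = "sum a {..<i}" and ?A' = "sum a {..<Suc i}" and ?B = "\<lambda>j. sum b {..<j}"
  \<comment> \<open>\<open>c\<close> clamps to the \<open>i\<close>-th block of \<open>a\<close>.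
    Each overlap is the increment of \<open>c\<close> between consecutive partial sums of
    \<open>b\<close>, so the sum telescopes; equality of the totals ensures that the block is
    exhausted at \<open>m\<close>.\<close>
  define c where "c t = min (max t ?A) ?A'" for t
  have "(\<Sum>j<k. overlap a b i j) + ?A = c (?B k)" for k
  proof (induction k)
    case 0
    then show ?case by (simp add: c_def)
  next
    case (Suc k)
    then show ?case by (auto simp: c_def overlap_def)
  qed
  moreover have "?A' \<le> ?B m"
    using assms by (metis Suc_leI finite_lessThan lessThan_subset_iff sum_mono2 zero_le)
  ultimately have "(\<Sum>j<m. overlap a b i j) + ?A = ?A'" by (auto simp: c_def)
  then show ?thesis by simp
qed

section \<open>Continuous functions with values in the natural numbers\<close>

lemma cont_nat_iff:
  "cont_nat X f \<longleftrightarrow> (\<forall>x\<in>topspace X. \<exists>U. openin X U \<and> x \<in> U \<and> (\<forall>y\<in>U. f y = f x))"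
proof
  assume f: "cont_nat X f"
  show "\<forall>x\<in>topspace X. \<exists>U. openin X U \<and> x \<in> U \<and> (\<forall>y\<in>U. f y = f x)"
  proof
    fix x assume "x \<in> topspace X"
    moreover have "openin X {y \<in> topspace X. f y \<in> {f x}}"
      using f unfolding cont_nat_def by (rule openin_continuous_map_preimage) simp
    ultimately show "\<exists>U. openin X U \<and> x \<in> U \<and> (\<forall>y\<in>U. f y = f x)"
      by (intro exI[of _ "{y \<in> topspace X. f y \<in> {f x}}"]) auto
  qed
next
  assume f: "\<forall>x\<in>topspace X. \<exists>U. openin X U \<and> x \<in> U \<and> (\<forall>y\<in>U. f y = f x)"
  have "openin X {x \<in> topspace X. f x \<in> V}" for V
  proof (subst openin_subopen, intro ballI)
    fix x assume x: "x \<in> {x \<in> topspace X. f x \<in> V}"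
    then obtain U where U: "openin X U" "x \<in> U" "\<forall>y\<in>U. f y = f x" using f by auto
    have "U \<subseteq> {x \<in> topspace X. f x \<in> V}"
    proof
      fix y assume "y \<in> U"
      moreover from this have "f y = f x" using U(3) by blast
      ultimately show "y \<in> {x \<in> topspace X. f x \<in> V}" using x openin_subset[OF U(1)] by auto
    qed
    then show "\<exists>T. openin X T \<and> x \<in> T \<and> T \<subseteq> {x \<in> topspace X. f x \<in> V}" using U(1,2) by blast
  qed
  then show "cont_nat X f" by (auto simp: cont_nat_def continuous_map_def)
qed

lemma cont_nat_const [simp]: "cont_nat X (\<lambda>_. c)"
  by (simp add: cont_nat_def)

text \<open>Both functions are constant on a common neighbourhood of each point, so \<open>F\<close>
  may be arbitrary: truncated subtraction, minimum, maximum or a test.\<close>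

lemma cont_nat_binop:
  assumes "cont_nat X f" "cont_nat X g"
  shows "cont_nat X (\<lambda>x. F (f x) (g x))"
  unfolding cont_nat_iff
proof
  fix x assume "x \<in> topspace X"
  then obtain U V where U: "openin X U" "x \<in> U" "\<And>y. y \<in> U \<Longrightarrow> f y = f x"
    and V: "openin X V" "x \<in> V" "\<And>y. y \<in> V \<Longrightarrow> g y = g x"
    using assms unfolding cont_nat_iff by metis
  have "F (f y) (g y) = F (f x) (g x)" if "y \<in> U \<inter> V" for y
    using that U(3)[of y] V(3)[of y] by (simp only: Int_iff)
  moreover have "openin X (U \<inter> V)" "x \<in> U \<inter> V" using U(1,2) V(1,2) by auto
  ultimately show "\<exists>U. openin X U \<and> x \<in> U \<and> (\<forall>y\<in>U. F (f y) (g y) = F (f x) (g x))" by blast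
qed

lemma cont_nat_add: "cont_nat X f \<Longrightarrow> cont_nat X g \<Longrightarrow> cont_nat X (\<lambda>x. f x + g x)"
  by (rule cont_nat_binop)

lemma cont_nat_diff: "cont_nat X f \<Longrightarrow> cont_nat X g \<Longrightarrow> cont_nat X (\<lambda>x. f x - g x)"
  by (rule cont_nat_binop)

lemma cont_nat_scale: "cont_nat X f \<Longrightarrow> cont_nat X (\<lambda>x. k * f x)"
  by (rule cont_nat_binop[OF cont_nat_const])

lemma cont_nat_sum: "(\<And>i. i \<in> J \<Longrightarrow> cont_nat X (h i)) \<Longrightarrow> cont_nat X (\<lambda>x. \<Sum>i\<in>J. h i x)"
  by (induction J rule: infinite_finite_induct) (auto intro: cont_nat_add)

lemma cont_nat_overlap:
  assumes "\<And>i. i < n \<Longrightarrow> cont_nat X (h i)" "\<And>j. j < m \<Longrightarrow> cont_nat X (k j)" "i < n" "j < m"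
  shows "cont_nat X (\<lambda>x. overlap (\<lambda>i. h i x) (\<lambda>j. k j x) i j)"
  unfolding overlap_def using assms
  by (intro cont_nat_diff cont_nat_binop[where F = min] cont_nat_binop[where F = max] cont_nat_sum) auto

lemma cont_nat_of_bool:
  assumes "openin X A" "closedin X A"
  shows "cont_nat X (\<lambda>x. of_bool (x \<in> A))"
  unfolding cont_nat_iff
proof
  fix x assume "x \<in> topspace X"
  then show "\<exists>U. openin X U \<and> x \<in> U \<and> (\<forall>y\<in>U. (of_bool (y \<in> A)::nat) = of_bool (x \<in> A))"
    using assms by (intro exI[of _ "if x \<in> A then A else topspace X - A"]) (auto simp: openin_diff)
qed


lemma clopen_cont_nat:
  assumes "cont_nat X f"
  shows "openin X {x \<in> topspace X. f x \<in> V} \<and> closedin X {x \<in> topspace X. f x \<in> V}"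
  using openin_continuous_map_preimage[OF assms[unfolded cont_nat_def], of V]
    closedin_continuous_map_preimage[OF assms[unfolded cont_nat_def], of V] by simp

lemma cont_nat_bounded:
  assumes "compact_space X" "cont_nat X f"
  shows "\<exists>N. \<forall>x\<in>topspace X. f x \<le> N"
proof -
  have "compactin (discrete_topology UNIV) (f ` topspace X)"
    using assms unfolding cont_nat_def compact_space_def by (rule image_compactin)
  then have "finite (f ` topspace X)" by (simp add: compactin_discrete_topology)
  then show ?thesis unfolding finite_nat_set_iff_bounded_le by blast
qed

section \<open>Equidecomposability and the algebraic preorder for a continuous action\<close>

locale topological_action =
  fixes G :: "('g, 'b) monoid_scheme" (structure) and X :: "'a topology" and act :: "'g \<Rightarrow> 'a \<Rightarrow> 'a"
  assumes continuous_action: "continuous_action G X act"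
begin

sublocale group_action G "topspace X" act
  using continuous_action by (simp add: continuous_action_def)

sublocale group G
  using group_hom group_hom.axioms(1) by blast

abbreviation equidec (infix "\<simeq>" 50) where "f \<simeq> g \<equiv> type_equiv G X act f g"
abbreviation below (infix "\<preceq>" 50) where "f \<preceq> g \<equiv> type_le G X act f g"

lemma act_in: "\<lbrakk>g \<in> carrier G; x \<in> topspace X\<rbrakk> \<Longrightarrow> act g x \<in> topspace X"
  using element_image by blast

lemma act_inv_act [simp]: "\<lbrakk>g \<in> carrier G; x \<in> topspace X\<rbrakk> \<Longrightarrow> act (inv g) (act g x) = x"
  using orbit_sym_aux by blast

lemma act_act_inv [simp]: "\<lbrakk>g \<in> carrier G; x \<in> topspace X\<rbrakk> \<Longrightarrow> act g (act (inv g) x) = x"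
  using act_inv_act[of "inv g" x] by simp

lemma act_one [simp]: "x \<in> topspace X \<Longrightarrow> act \<one> x = x"
  by (metis id_eq_one restrict_apply')

lemma cont_nat_act:
  assumes "g \<in> carrier G" "cont_nat X f"
  shows "cont_nat X (\<lambda>x. f (act g x))"
  using continuous_map_compose[of X X "act g" "discrete_topology UNIV" f] assms continuous_action
  by (simp add: cont_nat_def continuous_action_def comp_def)

lemma image_act_eq:
  assumes "g \<in> carrier G" "A \<subseteq> topspace X"
  shows "act g ` A = {x \<in> topspace X. act (inv g) x \<in> A}"
proof
  show "act g ` A \<subseteq> {x \<in> topspace X. act (inv g) x \<in> A}" using assms act_in by force
  show "{x \<in> topspace X. act (inv g) x \<in> A} \<subseteq> act g ` A"
  proof
    fix x assume "x \<in> {x \<in> topspace X. act (inv g) x \<in> A}"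
    then show "x \<in> act g ` A" using assms by (intro image_eqI[of _ _ "act (inv g) x"]) auto
  qed
qed

lemma image_act_inv: "\<lbrakk>g \<in> carrier G; A \<subseteq> topspace X\<rbrakk> \<Longrightarrow> act (inv g) ` act g ` A = A"
  by (force simp: image_image)

lemma clopen_image_act:
  assumes "g \<in> carrier G" "openin X A" "closedin X A"
  shows "openin X (act g ` A)" "closedin X (act g ` A)"
proof -
  have c: "continuous_map X X (act (inv g))"
    using continuous_action assms(1) by (simp add: continuous_action_def)
  show "openin X (act g ` A)" "closedin X (act g ` A)"
    unfolding image_act_eq[OF assms(1) openin_subset[OF assms(2)]]
    using openin_continuous_map_preimage[OF c assms(2)] closedin_continuous_map_preimage[OF c assms(3)]
    by auto
qed

text \<open>Arbitrary finite index sets are allowed, so that decompositions can be indexed by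
  disjoint sums and products without renumbering.\<close>

lemma type_equivI:
  assumes "finite J" "\<And>i. i \<in> J \<Longrightarrow> cont_nat X (h i)" "\<And>i. i \<in> J \<Longrightarrow> s i \<in> carrier G"
    and "\<And>x. x \<in> topspace X \<Longrightarrow> (\<Sum>i\<in>J. h i x) = f x"
    and "\<And>x. x \<in> topspace X \<Longrightarrow> (\<Sum>i\<in>J. h i (act (inv (s i)) x)) = g x"
  shows "f \<simeq> g"
proof -
  obtain b where b: "bij_betw b {..<card J} J"
    using assms(1) ex_bij_betw_nat_finite[of J] by (auto simp: atLeast0LessThan)
  then have "(\<Sum>i<card J. h (b i) x) = (\<Sum>i\<in>J. h i x)"
    "(\<Sum>i<card J. h (b i) (act (inv (s (b i))) x)) = (\<Sum>i\<in>J. h i (act (inv (s i)) x))" for x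
    by (rule sum.reindex_bij_betw)+
  moreover have "b i \<in> J" if "i < card J" for i using b that by (auto simp: bij_betw_def)
  ultimately show ?thesis
    unfolding type_equiv_def using assms
    by (intro exI[of _ "card J"] exI[of _ "\<lambda>i. h (b i)"] exI[of _ "\<lambda>i. s (b i)"]) auto
qed

lemma type_equivE:
  assumes "f \<simeq> g"
  obtains n :: nat and h s where "\<And>i. i < n \<Longrightarrow> cont_nat X (h i)" "\<And>i. i < n \<Longrightarrow> s i \<in> carrier G"
    "\<And>x. x \<in> topspace X \<Longrightarrow> (\<Sum>i<n. h i x) = f x"
    "\<And>x. x \<in> topspace X \<Longrightarrow> (\<Sum>i<n. h i (act (inv (s i)) x)) = g x"
  using assms unfolding type_equiv_def by blast

lemma type_equiv_eq: "cont_nat X f \<Longrightarrow> (\<And>x. x \<in> topspace X \<Longrightarrow> f x = g x) \<Longrightarrow> f \<simeq> g"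
  by (rule type_equivI[where J = "{0::nat}" and h = "\<lambda>_. f" and s = "\<lambda>_. \<one>"]) auto

lemma type_equiv_add:
  assumes "f \<simeq> g" "f' \<simeq> g'"
  shows "(\<lambda>x. f x + f' x) \<simeq> (\<lambda>x. g x + g' x)"
proof -
  obtain n :: nat and h s where *: "\<And>i. i < n \<Longrightarrow> cont_nat X (h i)" "\<And>i. i < n \<Longrightarrow> s i \<in> carrier G"
    "\<And>x. x \<in> topspace X \<Longrightarrow> (\<Sum>i<n. h i x) = f x"
    "\<And>x. x \<in> topspace X \<Longrightarrow> (\<Sum>i<n. h i (act (inv (s i)) x)) = g x"
    using assms(1) by (erule type_equivE)
  obtain m :: nat and k t where **: "\<And>i. i < m \<Longrightarrow> cont_nat X (k i)" "\<And>i. i < m \<Longrightarrow> t i \<in> carrier G"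
    "\<And>x. x \<in> topspace X \<Longrightarrow> (\<Sum>i<m. k i x) = f' x"
    "\<And>x. x \<in> topspace X \<Longrightarrow> (\<Sum>i<m. k i (act (inv (t i)) x)) = g' x"
    using assms(2) by (erule type_equivE)
  show ?thesis
    by (rule type_equivI[where J = "{..<n::nat} <+> {..<m::nat}" and h = "case_sum h k" and s = "case_sum s t"])
      (use * ** in \<open>auto simp: sum.Plus\<close>)
qed

lemma type_equiv_translate:
  assumes "g \<in> carrier G" "cont_nat X f"
  shows "f \<simeq> (\<lambda>x. f (act (inv g) x))"
  by (rule type_equivI[where J = "{0::nat}" and h = "\<lambda>_. f" and s = "\<lambda>_. g"]) (use assms in auto)

text \<open>This is Riesz refinement. The function \<open>g\<close> is split by the translated
  pieces of the first decomposition and by the pieces of the second; the \<open>overlap\<close>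
  matrix, formed pointwise, is a common refinement. Its entries are continuous because they arise
  from sums, minima, maxima and differences.\<close>

lemma type_equiv_trans:
  assumes "f \<simeq> g" "g \<simeq> l"
  shows "f \<simeq> l"
proof -
  obtain n :: nat and h s where h: "\<And>i. i < n \<Longrightarrow> cont_nat X (h i)" and s: "\<And>i. i < n \<Longrightarrow> s i \<in> carrier G"
    and hf: "\<And>x. x \<in> topspace X \<Longrightarrow> (\<Sum>i<n. h i x) = f x"
    and hg: "\<And>x. x \<in> topspace X \<Longrightarrow> (\<Sum>i<n. h i (act (inv (s i)) x)) = g x"
    using assms(1) by (erule type_equivE)
  obtain m :: nat and k t where k: "\<And>i. i < m \<Longrightarrow> cont_nat X (k i)" and t: "\<And>i. i < m \<Longrightarrow> t i \<in> carrier G"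
    and kg: "\<And>x. x \<in> topspace X \<Longrightarrow> (\<Sum>i<m. k i x) = g x"
    and kl: "\<And>x. x \<in> topspace X \<Longrightarrow> (\<Sum>i<m. k i (act (inv (t i)) x)) = l x"
    using assms(2) by (erule type_equivE)
  define r where "r i j x = overlap (\<lambda>i. h i (act (inv (s i)) x)) (\<lambda>j. k j x) i j" for i j x
  have r: "cont_nat X (r i j)" if "i < n" "j < m" for i j
    unfolding r_def using that h s k by (intro cont_nat_overlap cont_nat_act) auto
  have r_row: "(\<Sum>j<m. r i j x) = h i (act (inv (s i)) x)" if "i < n" "x \<in> topspace X" for i x
    unfolding r_def using that hg kg by (intro sum_overlap[of _ n]) auto
  have r_col: "(\<Sum>i<n. r i j x) = k j x" if "j < m" "x \<in> topspace X" for j x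
    unfolding r_def overlap_commute[of "\<lambda>i. h i (act (inv (s i)) x)"]
    using that hg kg by (intro sum_overlap[of _ m]) auto
  \<comment> \<open>The entries \<open>r i j\<close> live on the side of \<open>g\<close>. Piece
    \<open>(i, j)\<close> is pulled back along \<open>s i\<close> to the side of \<open>f\<close>,
    and then has to travel by \<open>s i\<close> followed by \<open>t j\<close>.\<close>
  define hh where "hh p x = r (fst p) (snd p) (act (s (fst p)) x)" for p x
  define tt where "tt p = t (snd p) \<otimes> s (fst p)" for p
  have J: "fst p < n" "snd p < m" if "p \<in> {..<n} \<times> {..<m}" for p
    using that by auto
  have hh: "cont_nat X (hh p)" and tt: "tt p \<in> carrier G" if "p \<in> {..<n} \<times> {..<m}" for p
    unfolding hh_def tt_def using J[OF that] by (auto intro!: cont_nat_act[of "s (fst p)"] r s t)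
  have f: "(\<Sum>p\<in>{..<n} \<times> {..<m}. hh p x) = f x" if x: "x \<in> topspace X" for x
  proof -
    have "(\<Sum>p\<in>{..<n} \<times> {..<m}. hh p x) = (\<Sum>i<n. \<Sum>j<m. r i j (act (s i) x))"
      by (simp add: sum.cartesian_product case_prod_beta hh_def)
    also have "\<dots> = (\<Sum>i<n. h i x)"
      using x s by (intro sum.cong refl) (auto simp: r_row act_in)
    finally show ?thesis using hf x by simp
  qed
  have l: "(\<Sum>p\<in>{..<n} \<times> {..<m}. hh p (act (inv (tt p)) x)) = l x" if x: "x \<in> topspace X" for x
  proof -
    have *: "act (s i) (act (inv (t j \<otimes> s i)) x) = act (inv (t j)) x" if "i < n" "j < m" for i j
      using that x s t composition_rule[of x "inv (s i)" "inv (t j)"]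
      by (simp add: inv_mult_group act_in)
    have "(\<Sum>p\<in>{..<n} \<times> {..<m}. hh p (act (inv (tt p)) x))
        = (\<Sum>i<n. \<Sum>j<m. r i j (act (s i) (act (inv (t j \<otimes> s i)) x)))"
      by (simp add: sum.cartesian_product case_prod_beta hh_def tt_def)
    also have "\<dots> = (\<Sum>i<n. \<Sum>j<m. r i j (act (inv (t j)) x))"
      by (intro sum.cong refl) (simp add: *)
    also have "\<dots> = (\<Sum>j<m. \<Sum>i<n. r i j (act (inv (t j)) x))"
      by (rule sum.swap)
    also have "\<dots> = (\<Sum>j<m. k j (act (inv (t j)) x))"
      using x t by (intro sum.cong refl) (auto simp: r_col act_in)
    finally show ?thesis using kl x by simp
  qed
  show ?thesis by (rule type_equivI[OF _ hh tt f l]) auto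
qed

lemma type_equiv_imp_le: "f \<simeq> g \<Longrightarrow> f \<preceq> g"
  unfolding type_le_def by (intro exI[of _ "\<lambda>_. 0"]) auto

lemma pointwise_imp_type_le:
  assumes "cont_nat X f" "cont_nat X g" "\<And>x. x \<in> topspace X \<Longrightarrow> f x \<le> g x"
  shows "f \<preceq> g"
proof -
  have c: "cont_nat X (\<lambda>x. g x - f x)" using assms by (intro cont_nat_diff)
  have "(\<lambda>x. f x + (g x - f x)) \<simeq> g"
    using assms by (intro type_equiv_eq cont_nat_add c) auto
  with c show ?thesis by (auto simp: type_le_def)
qed

lemma type_le_refl: "cont_nat X f \<Longrightarrow> f \<preceq> f"
  by (simp add: pointwise_imp_type_le)

lemma type_le_trans:
  assumes "f \<preceq> g" "g \<preceq> h"
  shows "f \<preceq> h"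
proof -
  obtain c where c: "cont_nat X c" "(\<lambda>x. f x + c x) \<simeq> g"
    using assms(1) by (auto simp: type_le_def)
  obtain d where d: "cont_nat X d" "(\<lambda>x. g x + d x) \<simeq> h"
    using assms(2) by (auto simp: type_le_def)
  have "(\<lambda>x. (f x + c x) + d x) \<simeq> (\<lambda>x. g x + d x)"
    by (intro type_equiv_add[OF c(2)] type_equiv_eq[OF d(1)]) simp
  then have "(\<lambda>x. f x + (c x + d x)) \<simeq> h"
    using type_equiv_trans[OF _ d(2)] by (simp add: add.assoc)
  with cont_nat_add[OF c(1) d(1)] show ?thesis
    unfolding type_le_def by (intro exI[of _ "\<lambda>x. c x + d x"] conjI)
qed

lemma type_le_add:
  assumes "f \<preceq> g" "f' \<preceq> g'"
  shows "(\<lambda>x. f x + f' x) \<preceq> (\<lambda>x. g x + g' x)"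
proof -
  obtain c where c: "cont_nat X c" "(\<lambda>x. f x + c x) \<simeq> g"
    using assms(1) by (auto simp: type_le_def)
  obtain c' where c': "cont_nat X c'" "(\<lambda>x. f' x + c' x) \<simeq> g'"
    using assms(2) by (auto simp: type_le_def)
  have "(\<lambda>x. (f x + f' x) + (c x + c' x)) \<simeq> (\<lambda>x. g x + g' x)"
    using type_equiv_add[OF c(2) c'(2)] by (simp add: ac_simps)
  with cont_nat_add[OF c(1) c'(1)] show ?thesis
    unfolding type_le_def by (intro exI[of _ "\<lambda>x. c x + c' x"] conjI)
qed

end

section \<open>Doubling and paradoxical comparison\<close>

lemma sum_of_bool_unique:
  assumes "finite J" "\<And>i j. i \<in> J \<Longrightarrow> j \<in> J \<Longrightarrow> P i \<Longrightarrow> P j \<Longrightarrow> i = j"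
  shows "(\<Sum>i\<in>J. of_bool (P i)) = (of_bool (\<exists>i\<in>J. P i) :: nat)"
proof (cases "\<exists>i\<in>J. P i")
  case True
  then obtain i where "i \<in> J" "P i" by blast
  then have "{j \<in> J. P j} = {i}" using assms(2) by blast
  then show ?thesis using assms(1) True by (simp add: sum_of_bool_eq Int_def)
qed simp

text \<open>A discrete intermediate value argument: partial sums grow by steps of at most 1, so each
  value below the total is left at some nonzero step.\<close>

lemma partial_sum_hits:
  fixes a :: "nat \<Rightarrow> nat"
  assumes "\<And>i. i < n \<Longrightarrow> a i \<le> 1" "k < sum a {..<n}"
  shows "\<exists>i<n. a i \<noteq> 0 \<and> sum a {..<i} = k"
  using assms
proof (induction n)
  case (Suc n)
  show ?case
  proof (cases "k < sum a {..<n}")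
    case True
    then show ?thesis using Suc by (meson less_SucI)
  next
    case False
    moreover have "a n \<le> 1" using Suc.prems(1) by simp
    ultimately show ?thesis using Suc.prems(2) by (intro exI[of _ n]) auto
  qed
qed simp

context topological_action
begin

text \<open>\<open>subequiv\<close> attaches one group element to each set of a collection, whereas
  an indexed family may repeat a set. Choosing one index for each set resolves this.\<close>

lemma subequivI:
  fixes n :: nat
  assumes "\<And>i. i < n \<Longrightarrow> openin X (D i)" "\<And>i. i < n \<Longrightarrow> s i \<in> carrier G"
    and "F \<subseteq> (\<Union>i<n. D i)" and "\<And>i. i < n \<Longrightarrow> act (s i) ` D i \<subseteq> W"
    and "\<And>i j. i < n \<Longrightarrow> j < n \<Longrightarrow> i \<noteq> j \<Longrightarrow> act (s i) ` D i \<inter> act (s j) ` D j = {}"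
  shows "subequiv G X act F W"
proof -
  define ix where "ix U = (SOME i. i < n \<and> D i = U)" for U
  have ix: "ix U < n" "D (ix U) = U" if "U \<in> D ` {..<n}" for U
    using someI_ex[of "\<lambda>i. i < n \<and> D i = U"] that unfolding ix_def by auto
  show ?thesis
    unfolding subequiv_def
  proof (intro exI[of _ "D ` {..<n}"] exI[of _ "\<lambda>U. s (ix U)"] conjI ballI impI)
    fix U V assume UV: "U \<in> D ` {..<n}" "V \<in> D ` {..<n}" "U \<noteq> V"
    then have "ix U \<noteq> ix V" using ix(2) by metis
    then show "act (s (ix U)) ` U \<inter> act (s (ix V)) ` V = {}"
      using assms(5)[of "ix U" "ix V"] ix UV by simp
  next
    fix U assume U: "U \<in> D ` {..<n}"
    show "act (s (ix U)) ` U \<subseteq> W" using assms(4)[of "ix U"] ix[OF U] by simp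
    show "s (ix U) \<in> carrier G" using assms(2) ix[OF U] by simp
    show "openin X U" using assms(1) U by blast
  qed (use assms(3) in auto)
qed

text \<open>A decomposition of \<open>2 1\<^sub>A + c\<close> into pieces whose translates add up to \<open>1\<^sub>A\<close> consists of indicator
  functions covering \<open>A\<close> at least twice; the parts of the pieces that form the first and the second layer
  of this covering give two disjoint copies of \<open>A\<close> in \<open>A\<close>.\<close>

lemma doubling_imp_disjoint_copies:
  assumes "A \<subseteq> topspace X" "A \<noteq> {}"
    and le: "(\<lambda>x. 2 * of_bool (x \<in> A)) \<preceq> (\<lambda>x. of_bool (x \<in> A))"
  shows "\<exists>W1 W2. openin X W1 \<and> openin X W2 \<and> W1 \<noteq> {} \<and> W2 \<noteq> {} \<and> W1 \<subseteq> A \<and> W2 \<subseteq> A \<and> W1 \<inter> W2 = {} \<and>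
    subequiv G X act A W1 \<and> subequiv G X act A W2"
proof -
  obtain c where "(\<lambda>x. 2 * of_bool (x \<in> A) + c x) \<simeq> (\<lambda>x. of_bool (x \<in> A))"
    using le by (auto simp: type_le_def)
  then obtain n :: nat and h s where h: "\<And>i. i < n \<Longrightarrow> cont_nat X (h i)" and s: "\<And>i. i < n \<Longrightarrow> s i \<in> carrier G"
    and hf: "\<And>x. x \<in> topspace X \<Longrightarrow> (\<Sum>i<n. h i x) = 2 * of_bool (x \<in> A) + c x"
    and hg: "\<And>x. x \<in> topspace X \<Longrightarrow> (\<Sum>i<n. h i (act (inv (s i)) x)) = of_bool (x \<in> A)"
    by (erule type_equivE)
  \<comment> \<open>Two different pieces that are nonzero at points moved to the same place would
    contribute at least 2 to a value of the indicator of \<open>A\<close>.\<close>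
  have at_most_one: "i = j" if ij: "i < n" "j < n" and xy: "x \<in> topspace X" "y \<in> topspace X"
     "h i x \<noteq> 0" "h j y \<noteq> 0" "act (s i) x = act (s j) y" for i j x y
  proof (rule ccontr)
    assume ne: "i \<noteq> j"
    let ?z = "act (s i) x"
    have z: "?z \<in> topspace X" using ij xy s act_in by blast
    have "(\<Sum>l\<in>{i, j}. h l (act (inv (s l)) ?z)) \<le> (\<Sum>l<n. h l (act (inv (s l)) ?z))"
      using ij by (intro sum_mono2) auto
    also have "\<dots> \<le> 1" using hg[OF z] by simp
    finally have "h i (act (inv (s i)) ?z) + h j (act (inv (s j)) ?z) \<le> 1" using ne by simp
    moreover have "act (inv (s i)) ?z = x" using ij(1) xy(1) s by (simp only: act_inv_act)
    moreover have "act (inv (s j)) ?z = y" unfolding xy(5) using ij(2) xy(2) s by (simp only: act_inv_act)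
    ultimately show False using xy(3,4) by simp
  qed
  have bound: "h i x \<le> of_bool (act (s i) x \<in> A)" if ix: "i < n" "x \<in> topspace X" for i x
  proof -
    let ?z = "act (s i) x"
    have "h i (act (inv (s i)) ?z) \<le> (\<Sum>l<n. h l (act (inv (s l)) ?z))"
      using ix by (intro member_le_sum[where f = "\<lambda>l. h l (act (inv (s l)) ?z)"]) auto
    then show ?thesis using hg[OF act_in[OF s[OF ix(1)] ix(2)]] ix s by simp
  qed
  \<comment> \<open>As the pieces take only the values 0 and 1, \<open>D k i\<close> consists of the
    points covered by piece \<open>i\<close> and by exactly \<open>k\<close> earlier pieces;
    \<open>k = 0\<close> is the first layer and \<open>k = 1\<close> the second.\<close>
  define D where "D k i = {x \<in> topspace X. h i x \<noteq> 0 \<and> (\<Sum>j<i. h j x) = k}" for k i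
  define W where "W k = (\<Union>i<n. act (s i) ` D k i)" for k
  have D_clopen: "openin X (D k i) \<and> closedin X (D k i)" if "i < n" for k i
  proof -
    have "cont_nat X (\<lambda>x. of_bool (h i x \<noteq> 0 \<and> (\<Sum>j<i. h j x) = k))"
      using that by (intro cont_nat_binop[where F = "\<lambda>a b. of_bool (a \<noteq> 0 \<and> b = k)"] h cont_nat_sum) auto
    from clopen_cont_nat[OF this, of "{0<..}"] show ?thesis by (simp add: D_def)
  qed
  have W_open: "openin X (W k)" for k
    unfolding W_def using D_clopen s clopen_image_act by (intro openin_Union) auto
  have W_sub: "act (s i) ` D k i \<subseteq> A" if "i < n" for k i
  proof
    fix y assume "y \<in> act (s i) ` D k i"
    then obtain x where "x \<in> topspace X" "h i x \<noteq> 0" "y = act (s i) x" by (auto simp: D_def)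
    then show "y \<in> A" using bound[OF that, of x] by (cases "act (s i) x \<in> A") auto
  qed
  have cover: "A \<subseteq> (\<Union>i<n. D k i)" if "k < 2" for k
  proof
    fix x assume x: "x \<in> A"
    then have xt: "x \<in> topspace X" using assms(1) by blast
    have "h i x \<le> 1" if "i < n" for i using bound[OF that xt] by (cases "act (s i) x \<in> A") auto
    moreover have "k < (\<Sum>i<n. h i x)" using hf[OF xt] x that by simp
    ultimately obtain i where "i < n" "h i x \<noteq> 0" "(\<Sum>j<i. h j x) = k"
      using partial_sum_hits[of n "\<lambda>i. h i x" k] by blast
    then show "x \<in> (\<Union>i<n. D k i)" using xt by (auto simp: D_def)
  qed
  have sub: "subequiv G X act A (W k)" if "k < 2" for k
  proof (rule subequivI[of n "D k" s])
    show "act (s i) ` D k i \<inter> act (s j) ` D k j = {}" if "i < n" "j < n" "i \<noteq> j" for i j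
      using at_most_one[OF that(1,2)] that(3) unfolding D_def by blast
  qed (use D_clopen s cover[OF that] in \<open>auto simp: W_def\<close>)
  have "W k \<noteq> {}" if "k < 2" for k
    using cover[OF that] assms(2) unfolding W_def by fastforce
  moreover have "W 0 \<inter> W 1 = {}"
  \<comment> \<open>A common point would come from the same piece by \<open>at_most_one\<close> and
    from the same point by injectivity, but that point cannot have both 0 and 1 earlier pieces over
    it.\<close>
  proof (rule ccontr)
    assume "W 0 \<inter> W 1 \<noteq> {}"
    then obtain y where "y \<in> W 0" "y \<in> W 1" by blast
    then obtain i j x x' where ij: "i < n" "j < n" and xx: "x \<in> D 0 i" "x' \<in> D 1 j"
      "y = act (s i) x" "y = act (s j) x'"
      unfolding W_def by blast
    have "i = j" using xx by (intro at_most_one[OF ij, of x x']) (auto simp: D_def)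
    moreover have "x = x'"
      using xx inj_onD[OF inj_prop[OF s[OF ij(1)]], of x x'] \<open>i = j\<close> by (auto simp: D_def)
    ultimately show False using xx by (simp add: D_def)
  qed
  moreover have "W k \<subseteq> A" for k unfolding W_def using W_sub by blast
  ultimately show ?thesis
    using sub W_open by (intro exI[of _ "W 0"] exI[of _ "W 1"]) auto
qed

end

section \<open>From paradoxical comparison to almost unperforation\<close>

locale compact_zero_dim_action = topological_action G X act
  for G :: "('g, 'b) monoid_scheme" (structure) and X :: "'a topology" and act +
  fixes \<B> :: "'a set set"
  assumes compact: "compact_space X" and countable_base: "countable \<B>" and base: "clopen_base X \<B>"
begin

lemma base_clopen: "B \<in> \<B> \<Longrightarrow> openin X B" "B \<in> \<B> \<Longrightarrow> closedin X B"
  using base by (auto simp: clopen_base_def)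

lemma base_refine:
  assumes "openin X U" "x \<in> U" obtains B where "B \<in> \<B>" "x \<in> B" "B \<subseteq> U"
  using base assms unfolding clopen_base_def by blast

lemma finite_base_cover:
  assumes "closedin X F" "F \<subseteq> \<Union>\<U>" "\<And>U. U \<in> \<U> \<Longrightarrow> openin X U"
  obtains \<F> where "finite \<F>" "\<F> \<subseteq> \<B>" "F \<subseteq> \<Union>\<F>" "\<And>B. B \<in> \<F> \<Longrightarrow> \<exists>U\<in>\<U>. B \<subseteq> U"
proof -
  have "F \<subseteq> \<Union>{B\<in>\<B>. \<exists>U\<in>\<U>. B \<subseteq> U}"
  proof
    fix x assume "x \<in> F"
    then obtain U where U: "U \<in> \<U>" "x \<in> U" using assms(2) by blast
    then obtain B where "B \<in> \<B>" "x \<in> B" "B \<subseteq> U" using base_refine assms(3) by blast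
    with U show "x \<in> \<Union>{B\<in>\<B>. \<exists>U\<in>\<U>. B \<subseteq> U}" by blast
  qed
  from compactinD[OF closedin_compact_space[OF compact assms(1)] _ this] base_clopen
  obtain \<F> where "finite \<F>" "\<F> \<subseteq> {B\<in>\<B>. \<exists>U\<in>\<U>. B \<subseteq> U}" "F \<subseteq> \<Union>\<F>" by auto
  then show thesis by (intro that[of \<F>]) auto
qed

lemma clopen_between:
  assumes "closedin X F" "openin X W" "F \<subseteq> W"
  obtains A where "openin X A" "closedin X A" "F \<subseteq> A" "A \<subseteq> W"
proof -
  obtain \<F> where "finite \<F>" "\<F> \<subseteq> \<B>" "F \<subseteq> \<Union>\<F>" "\<And>B. B \<in> \<F> \<Longrightarrow> \<exists>U\<in>{W}. B \<subseteq> U"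
    using finite_base_cover[OF assms(1), of "{W}"] assms(2,3) by auto
  then show thesis
    using base_clopen by (intro that[of "\<Union>\<F>"] openin_Union closedin_Union) blast+
qed

text \<open>The open cover is refined to finitely many clopen sets, which are made disjoint inside
  \<open>A\<close>; each piece inherits the group element of a cover member containing it. Pieces
  from different members land disjointly by hypothesis, and pieces from the same member are moved by
  the same element, hence stay disjoint.\<close>

lemma subequiv_imp_equidec:
  assumes A: "openin X A" "closedin X A" and "subequiv G X act A W"
  obtains h where "cont_nat X h" "(\<lambda>x. of_bool (x \<in> A)) \<simeq> h"
    "\<And>x. x \<in> topspace X \<Longrightarrow> h x \<le> of_bool (x \<in> W)"
proof -
  obtain \<U> s where \<U>: "\<And>U. U \<in> \<U> \<Longrightarrow> openin X U" "A \<subseteq> \<Union>\<U>"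
    and s: "\<And>U. U \<in> \<U> \<Longrightarrow> s U \<in> carrier G" "\<And>U. U \<in> \<U> \<Longrightarrow> act (s U) ` U \<subseteq> W"
    and disj: "\<And>U V. U \<in> \<U> \<Longrightarrow> V \<in> \<U> \<Longrightarrow> U \<noteq> V \<Longrightarrow> act (s U) ` U \<inter> act (s V) ` V = {}"
    using assms(3) unfolding subequiv_def by metis
  obtain \<F> where \<F>: "finite \<F>" "\<F> \<subseteq> \<B>" "A \<subseteq> \<Union>\<F>" "\<And>B. B \<in> \<F> \<Longrightarrow> \<exists>U\<in>\<U>. B \<subseteq> U"
    using finite_base_cover[OF A(2) \<U>(2,1)] by blast
  obtain u where u: "\<And>B. B \<in> \<F> \<Longrightarrow> u B \<in> \<U>" "\<And>B. B \<in> \<F> \<Longrightarrow> B \<subseteq> u B"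
    using \<F>(4) by metis
  obtain b where "bij_betw b {..<card \<F>} \<F>"
    using \<F>(1) ex_bij_betw_nat_finite[of \<F>] by (auto simp: atLeast0LessThan)
  then have b: "b ` {..<card \<F>} = \<F>" by (simp add: bij_betw_def)
  define D where "D i = A \<inter> (b i - (\<Union>j<i. b j))" for i
  define t where "t i = s (u (b i))" for i
  let ?N = "card \<F>"
  have bF: "b i \<in> \<F>" if "i < ?N" for i using b that by blast
  have t: "t i \<in> carrier G" if "i < ?N" for i unfolding t_def using bF[OF that] u s by blast
  have b_clopen: "openin X (b i)" "closedin X (b i)" if "i < ?N" for i
    using bF[OF that] \<F>(2) base_clopen by blast+
  have D_clopen: "openin X (D i)" "closedin X (D i)" if "i < ?N" for i
    unfolding D_def using that A b_clopen
    by (auto intro!: openin_Int closedin_Int openin_diff closedin_diff openin_Union closedin_Union)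
  have D_disj: "i = j" if "x \<in> D i" "x \<in> D j" for i j x
    using that unfolding D_def by (metis DiffE IntE UN_I lessThan_iff linorder_neqE_nat)
  have D_cover: "(\<exists>i<?N. x \<in> D i) \<longleftrightarrow> x \<in> A" for x
  proof
    assume x: "x \<in> A"
    then have "\<exists>i. i < ?N \<and> x \<in> b i" using \<F>(3) b by blast
    then obtain i where i: "i < ?N" "x \<in> b i" "\<And>j. j < i \<Longrightarrow> \<not> (j < ?N \<and> x \<in> b j)"
      using exists_least_iff[of "\<lambda>i. i < ?N \<and> x \<in> b i"] by blast
    then have "x \<in> D i" using x by (auto simp: D_def)
    with i(1) show "\<exists>i<?N. x \<in> D i" by blast
  qed (auto simp: D_def)
  have image: "act (t i) ` D i \<subseteq> act (s (u (b i))) ` u (b i)" if "i < ?N" for i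
    unfolding t_def D_def using u(2)[OF bF[OF that]] by blast
  have moved: "x \<in> act (t i) ` D i" if "i < ?N" "x \<in> topspace X" "act (inv (t i)) x \<in> D i" for i x
    using that t by (intro image_eqI[of _ _ "act (inv (t i)) x"]) auto
  have unique: "i = j" if ij: "i < ?N" "j < ?N" and x: "x \<in> topspace X"
    "act (inv (t i)) x \<in> D i" "act (inv (t j)) x \<in> D j" for i j x
  proof (cases "u (b i) = u (b j)")
    case True
    then show ?thesis using x D_disj by (simp add: t_def)
  next
    case False
    then have "act (s (u (b i))) ` u (b i) \<inter> act (s (u (b j))) ` u (b j) = {}"
      using ij u bF by (intro disj) auto
    then show ?thesis
      using subsetD[OF image[OF ij(1)] moved[OF ij(1) x(1,2)]]
        subsetD[OF image[OF ij(2)] moved[OF ij(2) x(1,3)]] by blast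
  qed
  define h :: "'a \<Rightarrow> nat" where "h x = (\<Sum>i<?N. of_bool (act (inv (t i)) x \<in> D i))" for x
  show thesis
  proof (rule that[of h])
    show "cont_nat X h"
      unfolding h_def using t D_clopen
      by (intro cont_nat_sum cont_nat_act[where f = "\<lambda>x. of_bool (x \<in> D i)" for i] cont_nat_of_bool) auto
    show "(\<lambda>x. of_bool (x \<in> A)) \<simeq> h"
    proof (rule type_equivI[of "{..<?N}" "\<lambda>i x. of_bool (x \<in> D i)" t])
      show "(\<Sum>i<?N. of_bool (x \<in> D i)) = (of_bool (x \<in> A) :: nat)" for x
        using sum_of_bool_unique[of "{..<?N}" "\<lambda>i. x \<in> D i"] D_disj D_cover[of x] by auto
    qed (use t D_clopen in \<open>auto intro: cont_nat_of_bool simp: h_def\<close>)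
    fix x assume x: "x \<in> topspace X"
    \<comment> \<open>At most one summand is nonzero at \<open>x\<close>, so \<open>h\<close> is the
      indicator of the union of the translated pieces.\<close>
    have "h x = of_bool (\<exists>i\<in>{..<?N}. act (inv (t i)) x \<in> D i)"
      unfolding h_def using unique x by (intro sum_of_bool_unique) auto
    moreover have "x \<in> W" if "i < ?N" "act (inv (t i)) x \<in> D i" for i
      using moved[OF that(1) x that(2)] image[OF that(1)] s(2)[OF u(1)[OF bF[OF that(1)]]] by blast
    ultimately show "h x \<le> of_bool (x \<in> W)" by auto
  qed
qed

text \<open>A clopen \<open>A\<close> may serve as both the open and the closed set in paradoxical
  comparison. The two copies of its indicator have disjoint supports inside \<open>A\<close>, so
  their sum stays below the indicator.\<close>

lemma paradoxical_imp_doubling_clopen: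
  assumes "paradoxical_comparison G X act" and A: "openin X A" "closedin X A"
  shows "(\<lambda>x. 2 * of_bool (x \<in> A)) \<preceq> (\<lambda>x. of_bool (x \<in> A))"
proof (cases "A = {}")
  case True
  then show ?thesis by (simp add: type_le_refl)
next
  case False
  then have "openin X A \<and> A \<noteq> {} \<and> closedin X A \<and> A \<subseteq> A" using A by simp
  with assms(1) obtain W1 W2 where W: "W1 \<subseteq> A" "W2 \<subseteq> A" "W1 \<inter> W2 = {}"
    "subequiv G X act A W1" "subequiv G X act A W2"
    unfolding paradoxical_comparison_def by meson
  obtain h1 where h1: "cont_nat X h1" "(\<lambda>x. of_bool (x \<in> A)) \<simeq> h1"
      "\<And>x. x \<in> topspace X \<Longrightarrow> h1 x \<le> of_bool (x \<in> W1)"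
    using W(4) by (erule subequiv_imp_equidec[OF A])
  obtain h2 where h2: "cont_nat X h2" "(\<lambda>x. of_bool (x \<in> A)) \<simeq> h2"
      "\<And>x. x \<in> topspace X \<Longrightarrow> h2 x \<le> of_bool (x \<in> W2)"
    using W(5) by (erule subequiv_imp_equidec[OF A])
  have "(\<lambda>x. of_bool (x \<in> A) + of_bool (x \<in> A)) \<preceq> (\<lambda>x. h1 x + h2 x)"
    using type_equiv_add[OF h1(2) h2(2)] by (rule type_equiv_imp_le)
  moreover have "(\<lambda>x. h1 x + h2 x) \<preceq> (\<lambda>x. of_bool (x \<in> A))"
  proof (rule pointwise_imp_type_le)
    fix x assume x: "x \<in> topspace X"
    have "h1 x + h2 x \<le> of_bool (x \<in> W1) + of_bool (x \<in> W2)"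
      using h1(3)[OF x] h2(3)[OF x] by (rule add_mono)
    also have "\<dots> \<le> of_bool (x \<in> A)" using W(1-3) by auto
    finally show "h1 x + h2 x \<le> of_bool (x \<in> A)" .
  qed (intro cont_nat_add cont_nat_of_bool h1(1) h2(1) A)+
  ultimately show ?thesis using type_le_trans by (simp add: mult_2)
qed

text \<open>Peel off one layer: \<open>f\<close> is the indicator of the clopen set where
  \<open>f > 0\<close> plus the truncated difference \<open>f - 1\<close>, whose bound is smaller by
  1. Compactness supplies the bound on which the induction runs.\<close>

lemma doubling_clopen_imp_doubling:
  assumes doubling: "\<And>A. openin X A \<Longrightarrow> closedin X A \<Longrightarrow> (\<lambda>x. 2 * of_bool (x \<in> A)) \<preceq> (\<lambda>x. of_bool (x \<in> A))"
    and f: "cont_nat X f"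
  shows "(\<lambda>x. 2 * f x) \<preceq> f"
proof -
  have "(\<lambda>x. 2 * f x) \<preceq> f" if "cont_nat X f" "\<And>x. x \<in> topspace X \<Longrightarrow> f x \<le> N" for N f
    using that
  proof (induction N arbitrary: f)
    case 0
    then show ?case by (intro pointwise_imp_type_le cont_nat_scale) auto
  next
    case (Suc N)
    let ?A = "{x \<in> topspace X. f x \<in> {0<..}}"
    have A: "openin X ?A" "closedin X ?A" using clopen_cont_nat[OF Suc.prems(1), of "{0<..}"] by blast+
    have f1: "cont_nat X (\<lambda>x. f x - 1)" using Suc.prems(1) by (intro cont_nat_diff) auto
    have "(\<lambda>x. 2 * (f x - 1)) \<preceq> (\<lambda>x. f x - 1)"
      using Suc.prems(2) by (intro Suc.IH f1) (auto simp: le_diff_conv)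
    with doubling[OF A] have *: "(\<lambda>x. 2 * of_bool (x \<in> ?A) + 2 * (f x - 1)) \<preceq> (\<lambda>x. of_bool (x \<in> ?A) + (f x - 1))"
      by (rule type_le_add)
    have "(\<lambda>x. 2 * f x) \<preceq> (\<lambda>x. 2 * of_bool (x \<in> ?A) + 2 * (f x - 1))"
      using Suc.prems(1) f1 A by (intro pointwise_imp_type_le cont_nat_add cont_nat_scale cont_nat_of_bool) auto
    moreover have "(\<lambda>x. of_bool (x \<in> ?A) + (f x - 1)) \<preceq> f"
      using Suc.prems(1) f1 A by (intro pointwise_imp_type_le cont_nat_add cont_nat_scale cont_nat_of_bool) auto
    ultimately show ?case using * type_le_trans by blast
  qed
  with cont_nat_bounded[OF compact f] f show ?thesis by blast
qed

lemma scale_doubling: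
  assumes f: "cont_nat X f" and doubling: "(\<lambda>x. 2 * f x) \<preceq> f"
  shows "(\<lambda>x. n * f x) \<preceq> f"
proof (induction n)
  case 0
  then show ?case using f by (intro pointwise_imp_type_le) auto
next
  case (Suc n)
  have "(\<lambda>x. f x + n * f x) \<preceq> (\<lambda>x. f x + f x)" by (intro type_le_add Suc.IH type_le_refl f)
  with doubling show ?case using type_le_trans by (simp add: mult_2)
qed

lemma paradoxical_imp_almost_unperforated:
  assumes "paradoxical_comparison G X act"
  shows "almost_unperforated G X act"
  unfolding almost_unperforated_def
proof (intro allI impI, elim conjE)
  fix f g n assume fg: "cont_nat X f" "cont_nat X g" and le: "(\<lambda>x. (n + 1) * f x) \<preceq> (\<lambda>x. n * g x)"
  have "f \<preceq> (\<lambda>x. (n + 1) * f x)" using fg by (intro pointwise_imp_type_le cont_nat_scale) auto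
  moreover have "(\<lambda>x. n * g x) \<preceq> g"
    by (rule scale_doubling[OF fg(2) doubling_clopen_imp_doubling[OF
            paradoxical_imp_doubling_clopen[OF assms] fg(2)]])
  ultimately show "f \<preceq> g" using le by (meson type_le_trans)
qed

end

section \<open>Invariant measures\<close>

text \<open>The Caratheodory extension is stated for the outer measure itself, so that the explicit
  formula remains available for proving invariance.\<close>

lemma (in ring_of_sets) measure_space_outer_measure:
  assumes "positive M f" "countably_additive M f"
  shows "measure_space \<Omega> (sigma_sets \<Omega> M) (outer_measure M f)"
proof -
  let ?L = "lambda_system \<Omega> (Pow \<Omega>) (outer_measure M f)"
  have add: "additive M f" using assms countably_additive_additive by blast
  then have inc: "increasing M f" using assms(1) additive_increasing by blast
  have L: "measure_space \<Omega> ?L (outer_measure M f)"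
    by (rule sigma_algebra.caratheodory_lemma[OF sigma_algebra_Pow
          outer_measure_space_outer_measure[OF assms(1) inc]])
  then have "sigma_sets \<Omega> M \<subseteq> ?L"
    using sigma_algebra.sigma_sets_subset[of \<Omega> ?L M] algebra_subset_lambda_system[OF assms(1) inc add]
    by (simp add: measure_space_def)
  with L show ?thesis
    using measure_down sigma_algebra_sigma_sets[OF space_closed] by blast
qed

context compact_zero_dim_action
begin

definition clopens :: "'a set set" where
  "clopens = {B. openin X B \<and> closedin X B}"

lemma algebra_clopens: "algebra (topspace X) clopens"
  unfolding algebra_iff_Un clopens_def by (auto dest: openin_subset)

text \<open>Every open set is a union of members of the countable clopen base.\<close>

lemma sigma_sets_clopens:
  "sigma_sets (topspace X) clopens = sigma_sets (topspace X) {U. openin X U}"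
proof (rule sigma_sets_eqI)
  fix U assume "U \<in> {U. openin X U}"
  then have U: "openin X U" by simp
  have "U = \<Union>{B\<in>\<B>. B \<subseteq> U}" using base_refine[OF U] by blast
  moreover have "\<Union>{B\<in>\<B>. B \<subseteq> U} \<in> sigma_sets (topspace X) clopens"
    using countable_base base_clopen by (intro sigma_sets_UNION) (auto simp: clopens_def)
  ultimately show "U \<in> sigma_sets (topspace X) clopens" by simp
qed (auto simp: clopens_def)

text \<open>A clopen union is compact, so finitely many of the disjoint clopen sets cover it. The
  others are disjoint from these and therefore empty, which reduces the series to a finite
  sum.\<close>

lemma clopen_additive_imp_countably_additive:
  assumes "positive clopens m" "additive clopens m"
  shows "countably_additive clopens m"
  unfolding countably_additive_def
proof (intro allI impI)
  interpret algebra "topspace X" clopens by (rule algebra_clopens)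
  fix D :: "nat \<Rightarrow> 'a set"
  assume D: "range D \<subseteq> clopens" "disjoint_family D" and U: "(\<Union>i. D i) \<in> clopens"
  have "compactin X (\<Union>i. D i)" using U compact closedin_compact_space by (auto simp: clopens_def)
  moreover have "openin X V" if "V \<in> range D" for V using D(1) that by (auto simp: clopens_def)
  ultimately obtain \<F> where \<F>: "finite \<F>" "\<F> \<subseteq> range D" "(\<Union>i. D i) \<subseteq> \<Union>\<F>"
    using compactinD[of X "\<Union>i. D i" "range D"] by blast
  then obtain K where K: "finite K" "\<F> = D ` K" by (meson finite_subset_image)
  have "D i = {}" if "i \<notin> K" for i
  proof -
    have "D i \<subseteq> (\<Union>j\<in>K. D j)" using \<F>(3) K(2) by blast
    moreover have "D i \<inter> D j = {}" if "j \<in> K" for j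
    proof -
      have "i \<noteq> j" using that \<open>i \<notin> K\<close> by blast
      then show ?thesis using D(2) by (simp add: disjoint_family_on_def)
    qed
    ultimately show ?thesis by blast
  qed
  then have "(\<Sum>i. m (D i)) = (\<Sum>i\<in>K. m (D i))"
    using K(1) assms(1) by (intro suminf_finite) (auto simp: positive_def)
  also have "\<dots> = m (\<Union>i\<in>K. D i)"
    using D K(1) by (intro additive_sum assms) (auto simp: disjoint_family_on_def)
  also have "(\<Union>i\<in>K. D i) = (\<Union>i. D i)" using \<F>(3) K(2) by blast
  finally show "(\<Sum>i. m (D i)) = m (\<Union>i. D i)" .
qed

text \<open>Translating a disjoint clopen cover of \<open>S\<close> gives one of the image with the
  same total. Applied to \<open>inv g\<close> and the image, this also yields the reverse
  inequality.\<close>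

lemma outer_measure_act_le:
  assumes inv: "\<And>g B. g \<in> carrier G \<Longrightarrow> B \<in> clopens \<Longrightarrow> m (act g ` B) = m B"
    and g: "g \<in> carrier G"
  shows "outer_measure clopens m (act g ` S) \<le> outer_measure clopens m S"
  unfolding outer_measure_def[of clopens m S]
proof (rule INF_greatest, elim CollectE conjE)
  fix D :: "nat \<Rightarrow> 'a set"
  assume D: "range D \<subseteq> clopens" "disjoint_family D" "S \<subseteq> (\<Union>i. D i)"
  have Dc: "D i \<in> clopens" for i using D(1) by blast
  then have Dt: "D i \<subseteq> topspace X" for i using openin_subset by (auto simp: clopens_def)
  have "range (\<lambda>i. act g ` D i) \<subseteq> clopens"
    using Dc clopen_image_act[OF g] by (auto simp: clopens_def)
  moreover have "disjoint_family (\<lambda>i. act g ` D i)"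
    unfolding disjoint_family_on_def
  proof (intro ballI impI)
    fix i j :: nat assume "i \<noteq> j"
    then have "D i \<inter> D j = {}" using D(2) by (simp add: disjoint_family_on_def)
    then show "act g ` D i \<inter> act g ` D j = {}"
      using inj_on_image_Int[OF inj_prop[OF g] Dt Dt, of i j] by simp
  qed
  moreover have "act g ` S \<subseteq> (\<Union>i. act g ` D i)" using D(3) by blast
  ultimately have "outer_measure clopens m (act g ` S) \<le> (\<Sum>i. m (act g ` D i))"
    unfolding outer_measure_def by (intro INF_lower) blast
  also have "\<dots> = (\<Sum>i. m (D i))" using inv[OF g Dc] by simp
  finally show "outer_measure clopens m (act g ` S) \<le> (\<Sum>i. m (D i))" .
qed

lemma image_act_Borel:
  assumes g: "g \<in> carrier G" and "S \<in> sigma_sets (topspace X) clopens"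
  shows "act g ` S \<in> sigma_sets (topspace X) clopens"
  using assms(2)
proof (induction rule: sigma_sets.induct)
  case (Basic B)
  then show ?case using clopen_image_act[OF g] by (auto simp: clopens_def)
next
  case (Compl B)
  have "B \<subseteq> topspace X"
    using sigma_sets_into_sp[OF _ Compl(1)] openin_subset by (auto simp: clopens_def)
  then have "act g ` (topspace X - B) = topspace X - act g ` B"
    using inj_on_image_set_diff[OF inj_prop[OF g], of "topspace X" B] surj_prop[OF g] by simp
  with Compl show ?case by (simp add: sigma_sets.Compl)
next
  case (Union B)
  then show ?case by (simp add: image_UN sigma_sets.Union)
qed (simp add: sigma_sets.Empty)

text \<open>Uniqueness of the extension is not available, as the measure need not be sigma-finite;
  the outer measure is invariant by construction.\<close>

lemma invariant_clopen_measure_extends: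
  assumes pos: "positive clopens m" and add: "additive clopens m"
    and inv: "\<And>g B. g \<in> carrier G \<Longrightarrow> B \<in> clopens \<Longrightarrow> m (act g ` B) = m B"
  shows "\<exists>M. borel_measure_on X M \<and> invariant_measure G act M \<and> (\<forall>B\<in>clopens. emeasure M B = m B)"
proof -
  interpret algebra "topspace X" clopens by (rule algebra_clopens)
  let ?\<Sigma> = "sigma_sets (topspace X) clopens"
  let ?O = "outer_measure clopens m"
  define M where "M = measure_of (topspace X) ?\<Sigma> ?O"
  have ca: "countably_additive clopens m" by (intro clopen_additive_imp_countably_additive pos add)
  have sub: "?\<Sigma> \<subseteq> Pow (topspace X)"
    using sigma_sets_into_sp[OF space_closed] by blast
  have ms: "sigma_algebra (topspace X) ?\<Sigma>" "positive ?\<Sigma> ?O" "countably_additive ?\<Sigma> ?O"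
    using measure_space_outer_measure[OF pos ca] by (auto simp: measure_space_def)
  have emeasure_M: "emeasure M S = ?O S" if "S \<in> ?\<Sigma>" for S
    unfolding M_def by (rule emeasure_measure_of_sigma[OF ms that])
  have sets_M: "sets M = ?\<Sigma>"
    unfolding M_def using sub by (simp add: sets_measure_of sigma_algebra.sigma_sets_eq[OF ms(1)])
  have "space M = topspace X" unfolding M_def using sub by (rule space_measure_of)
  then have "borel_measure_on X M" by (simp add: borel_measure_on_def sets_M sigma_sets_clopens)
  moreover have "invariant_measure G act M"
    unfolding invariant_measure_def sets_M
  proof (intro ballI)
    fix g S assume g: "g \<in> carrier G" and S: "S \<in> ?\<Sigma>"
    have "act (inv g) ` act g ` S = S" using g S sub by (intro image_act_inv) auto
    then have "?O S \<le> ?O (act g ` S)"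
      using outer_measure_act_le[where m = m, OF inv, of "inv g" "act g ` S"] g by simp
    moreover have "?O (act g ` S) \<le> ?O S"
      using outer_measure_act_le[where m = m, OF inv g] .
    ultimately show "emeasure M (act g ` S) = emeasure M S"
      using emeasure_M[OF S] emeasure_M[OF image_act_Borel[OF g S]] by simp
  qed
  moreover have "emeasure M B = m B" if "B \<in> clopens" for B
    using emeasure_M[of B] outer_measure_agrees[OF pos ca that] that by auto
  ultimately show ?thesis by blast
qed

section \<open>From states on the type semigroup to invariant measures\<close>

lemma not_paradoxical_imp_invariant_measure:
  assumes A: "openin X A" "closedin X A"
    and np: "\<And>n::nat. \<not> (\<lambda>x. (n + 1) * of_bool (x \<in> A)) \<preceq> (\<lambda>x. n * of_bool (x \<in> A))"
  shows "\<exists>M. borel_measure_on X M \<and> invariant_measure G act M \<and> nontrivial_measure X M"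
proof -
  let ?e = "\<lambda>x. of_bool (x \<in> A) :: nat"
  \<comment> \<open>The order ideal generated by the indicator of \<open>A\<close>, on which a state
    normalised at \<open>A\<close> can be finite.\<close>
  define I where "I = {f. cont_nat X f \<and> (\<exists>m::nat. f \<preceq> (\<lambda>x. m * ?e x))}"
  have e: "cont_nat X ?e" using A by (rule cont_nat_of_bool)
  have I_cont: "cont_nat X f" if "f \<in> I" for f using that by (simp add: I_def)
  have I_down: "f \<in> I" if "cont_nat X f" "f \<preceq> g" "g \<in> I" for f g
    using that type_le_trans unfolding I_def by blast
  interpret cone: preordered_function_cone I "type_le G X act" ?e
  proof
    show "(\<lambda>_. 0) \<in> I"
      unfolding I_def by (auto intro!: exI[of _ 0] type_le_refl)
    show "?e \<in> I"
      unfolding I_def using e by (auto intro!: exI[of _ 1] type_le_refl)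
    fix f assume f: "f \<in> I"
    show "f \<preceq> f" using I_cont[OF f] by (rule type_le_refl)
    show "\<exists>m::nat. f \<preceq> (\<lambda>x. m * ?e x)" using f by (simp add: I_def)
    fix g assume g: "g \<in> I"
    show "f \<preceq> (\<lambda>x. f x + g x)"
      using I_cont f g by (intro pointwise_imp_type_le cont_nat_add) auto
    obtain m k :: nat where "f \<preceq> (\<lambda>x. m * ?e x)" "g \<preceq> (\<lambda>x. k * ?e x)"
      using f g by (auto simp: I_def)
    then have "(\<lambda>x. f x + g x) \<preceq> (\<lambda>x. (m + k) * ?e x)"
      using type_le_add by (simp add: add_mult_distrib)
    then show "(\<lambda>x. f x + g x) \<in> I"
      using cont_nat_add[OF I_cont[OF f] I_cont[OF g]] by (auto simp: I_def)
    fix h assume "h \<in> I" "f \<preceq> g"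
    then show "(\<lambda>x. f x + h x) \<preceq> (\<lambda>x. g x + h x)"
      using I_cont by (intro type_le_add type_le_refl)
  next
    fix f g h assume "f \<preceq> g" "g \<preceq> h"
    then show "f \<preceq> h" by (rule type_le_trans)
  next
    show "\<not> (\<lambda>x. (n + 1) * ?e x) \<preceq> (\<lambda>x. n * ?e x)" for n by (rule np)
  qed
  obtain \<nu> where nonneg: "\<And>f. 0 \<le> \<nu> f" and norm: "\<nu> ?e = (1::real)"
    and add: "\<And>f g. \<lbrakk>f \<in> I; g \<in> I\<rbrakk> \<Longrightarrow> \<nu> (\<lambda>x. f x + g x) = \<nu> f + \<nu> g"
    and mono: "\<And>f g. \<lbrakk>f \<in> I; g \<in> I; f \<preceq> g\<rbrakk> \<Longrightarrow> \<nu> f \<le> \<nu> g"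
    using cone.state_exists by blast
  define ind :: "'a set \<Rightarrow> 'a \<Rightarrow> nat" where "ind B x = of_bool (x \<in> B)" for B x
  \<comment> \<open>Clopen sets outside the ideal receive the value \<infinity>. This respects
    monotonicity because the ideal is closed downwards.\<close>
  define m where "m B = (if ind B \<in> I then ennreal (\<nu> (ind B)) else \<infinity>)" for B
  have ind_cont: "cont_nat X (ind B)" if "B \<in> clopens" for B
    using cont_nat_of_bool that unfolding ind_def clopens_def by auto
  have m_mono: "m B \<le> m C" if "B \<in> clopens" "C \<in> clopens" "ind B \<preceq> ind C" for B C
    using I_down[OF ind_cont[OF that(1)] that(3)] mono[OF _ _ that(3)] nonneg
    by (auto simp: m_def intro: ennreal_leI)
  have "ind {} = (\<lambda>_. 0)" by (simp add: ind_def fun_eq_iff)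
  moreover have "\<nu> (\<lambda>_. 0) = 0" using add[OF cone.zero_in cone.zero_in] by simp
  ultimately have "positive clopens m" using cone.zero_in by (simp add: positive_def m_def)
  moreover have "additive clopens m"
    unfolding additive_def
  proof (intro ballI impI)
    fix B C assume BC: "B \<in> clopens" "C \<in> clopens" "B \<inter> C = {}"
    have eq: "ind (B \<union> C) = (\<lambda>x. ind B x + ind C x)"
      using BC(3) by (auto simp: ind_def fun_eq_iff)
    have BC': "B \<union> C \<in> clopens" using BC by (auto simp: clopens_def)
    have "ind B \<preceq> ind (B \<union> C)" "ind C \<preceq> ind (B \<union> C)"
      by (rule pointwise_imp_type_le[OF ind_cont[OF BC(1)] ind_cont[OF BC']], simp add: ind_def)
        (rule pointwise_imp_type_le[OF ind_cont[OF BC(2)] ind_cont[OF BC']], simp add: ind_def)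
    then have "ind B \<in> I" "ind C \<in> I" if "ind (B \<union> C) \<in> I"
      using I_down[OF ind_cont _ that] BC(1,2) by auto
    \<comment> \<open>Hence infinite values occur on both sides of the additivity equation at once,
      and otherwise additivity of \<nu> applies.\<close>
    then have "ind (B \<union> C) \<in> I \<longleftrightarrow> ind B \<in> I \<and> ind C \<in> I"
      using cone.add_in eq by auto
    then show "m (B \<union> C) = m B + m C"
      using nonneg by (auto simp: m_def eq add)
  qed
  moreover have "m (act g ` B) = m B" if g: "g \<in> carrier G" and B: "B \<in> clopens" for g B
  proof (rule antisym)
    have Bt: "B \<subseteq> topspace X" using B openin_subset by (auto simp: clopens_def)
    have gB: "act g ` B \<in> clopens" using clopen_image_act[OF g] B by (auto simp: clopens_def)
    \<comment> \<open>Only one inequality is needed for each group element; the other follows by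
      translating back with the inverse.\<close>
    have translate: "ind C \<preceq> ind (act k ` C)"
      if k: "k \<in> carrier G" and C: "C \<in> clopens" "act k ` C \<in> clopens" for k C
    proof -
      have "C \<subseteq> topspace X" using C openin_subset by (auto simp: clopens_def)
      then have "ind C (act (inv k) x) = ind (act k ` C) x" if "x \<in> topspace X" for x
        using image_act_eq[OF k] that by (simp add: ind_def)
      then have "(\<lambda>x. ind C (act (inv k) x)) \<simeq> ind (act k ` C)"
        using k C by (intro type_equiv_eq cont_nat_act ind_cont) auto
      then show ?thesis
        using type_equiv_trans[OF type_equiv_translate[OF k ind_cont[OF C(1)]]] type_equiv_imp_le by blast
    qed
    show "m B \<le> m (act g ` B)" using m_mono[OF B gB] translate[OF g B gB] by blast
    have "act (inv g) ` act g ` B = B" using image_act_inv[OF g Bt] .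
    then show "m (act g ` B) \<le> m B"
      using m_mono[OF gB B] translate[of "inv g" "act g ` B"] g B gB by simp
  qed
  ultimately obtain M where M: "borel_measure_on X M" "invariant_measure G act M"
    "\<forall>B\<in>clopens. emeasure M B = m B"
    using invariant_clopen_measure_extends by blast
  have "ind A = ?e" by (simp add: ind_def fun_eq_iff)
  then have "emeasure M A = 1" using M(3) A cone.e_in norm by (simp add: clopens_def m_def)
  then have "nontrivial_measure X M" unfolding nontrivial_measure_def using A by (intro exI[of _ A]) simp
  with M show ?thesis by blast
qed

section \<open>From almost unperforation to paradoxical comparison\<close>

lemma almost_unperforated_imp_paradoxical:
  assumes au: "almost_unperforated G X act"
    and no_measure: "\<not> (\<exists>M. borel_measure_on X M \<and> invariant_measure G act M \<and> nontrivial_measure X M)"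
  shows "paradoxical_comparison G X act"
  unfolding paradoxical_comparison_def
proof (intro allI impI, elim conjE)
  fix W F assume W: "openin X W" "W \<noteq> {}" and F: "closedin X F" "F \<subseteq> W"
  obtain A1 where A1: "openin X A1" "closedin X A1" "F \<subseteq> A1" "A1 \<subseteq> W"
    using clopen_between[OF F(1) W(1) F(2)] .
  \<comment> \<open>If \<open>F\<close> is empty, \<open>A1\<close> may be empty too. Adding a base
    set around a point of \<open>W\<close> makes \<open>A\<close> nonempty, which the disjoint
    copies must be as well.\<close>
  obtain w where w: "w \<in> W" using W(2) by blast
  obtain B where B: "B \<in> \<B>" "w \<in> B" "B \<subseteq> W" using base_refine[OF W(1) w] .
  define A where "A = A1 \<union> B"
  have A: "openin X A" "closedin X A" "F \<subseteq> A" "A \<subseteq> W" "A \<noteq> {}"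
    using A1 B base_clopen[OF B(1)] by (auto simp: A_def)
  let ?e = "\<lambda>x. of_bool (x \<in> A) :: nat"
  have e: "cont_nat X ?e" using A(1,2) by (rule cont_nat_of_bool)
  obtain n :: nat where n: "(\<lambda>x. (n + 1) * ?e x) \<preceq> (\<lambda>x. n * ?e x)"
    using not_paradoxical_imp_invariant_measure[OF A(1,2)] no_measure by blast
  \<comment> \<open>Each further copy of the indicator is swallowed by one more application of
    \<open>n\<close>.\<close>
  have absorb: "(\<lambda>x. (n + k) * ?e x) \<preceq> (\<lambda>x. n * ?e x)" for k :: nat
  proof (induction k)
    case 0
    show ?case using e by (simp add: type_le_refl cont_nat_scale)
  next
    case (Suc k)
    have "(\<lambda>x. (n + 1) * ?e x + k * ?e x) \<preceq> (\<lambda>x. n * ?e x + k * ?e x)"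
      using n e by (intro type_le_add type_le_refl cont_nat_scale)
    then have "(\<lambda>x. (n + Suc k) * ?e x) \<preceq> (\<lambda>x. (n + k) * ?e x)"
      by (simp add: algebra_simps)
    then show ?case using Suc.IH type_le_trans by blast
  qed
  \<comment> \<open>The shift ensures \<open>?N \<ge> 1\<close>, as
    \<open>almost_unperforated\<close> requires. The count below is
    \<open>(?N + 1) * 2 = n + (n + 4)\<close>, which explains the argument of
    \<open>absorb\<close>.\<close>
  let ?N = "n + 1"
  have "(\<lambda>x. (?N + 1) * (2 * ?e x)) \<preceq> (\<lambda>x. n * ?e x)"
    using absorb[of "n + 4"] by (simp add: algebra_simps)
  moreover have "(\<lambda>x. n * ?e x) \<preceq> (\<lambda>x. ?N * ?e x)"
    using e by (intro pointwise_imp_type_le cont_nat_scale) auto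
  ultimately have "(\<lambda>x. (?N + 1) * (2 * ?e x)) \<preceq> (\<lambda>x. ?N * ?e x)" by (rule type_le_trans)
  then have "(\<lambda>x. 2 * ?e x) \<preceq> ?e"
    using au[unfolded almost_unperforated_def, rule_format, of "\<lambda>x. 2 * ?e x" ?e ?N] e cont_nat_scale[OF e, of 2]
    by simp
  then obtain W1 W2 where W12: "openin X W1" "openin X W2" "W1 \<noteq> {}" "W2 \<noteq> {}" "W1 \<subseteq> A" "W2 \<subseteq> A"
    "W1 \<inter> W2 = {}" "subequiv G X act A W1" "subequiv G X act A W2"
    using doubling_imp_disjoint_copies[OF openin_subset[OF A(1)] A(5)] by metis
  \<comment> \<open>A cover of \<open>A\<close> is a cover of \<open>F\<close>, so the same sets and
    group elements work.\<close>
  have mono: "subequiv G X act F V" if "subequiv G X act A V" for V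
    using that unfolding subequiv_def
    by (elim ex_forward, elim conjE, intro conjI) (assumption | rule order_trans[OF A(3)])+
  show "\<exists>W1 W2. openin X W1 \<and> openin X W2 \<and> W1 \<noteq> {} \<and> W2 \<noteq> {} \<and> W1 \<subseteq> W \<and> W2 \<subseteq> W \<and>
      W1 \<inter> W2 = {} \<and> subequiv G X act F W1 \<and> subequiv G X act F W2"
    by (intro exI[of _ W1] exI[of _ W2] conjI mono W12 order_trans[OF W12(5) A(4)] order_trans[OF W12(6) A(4)])
qed

end

theorem theorem1p6:
  fixes G :: "('g, 'b) monoid_scheme" and X :: "'a topology" and act :: "'g \<Rightarrow> 'a \<Rightarrow> 'a"
  assumes "group G" and "countable (carrier G)" and "infinite (carrier G)"
    and "X homeomorphic_space cantor_space"
    and "continuous_action G X act"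
    and "\<not> (\<exists>M. borel_measure_on X M \<and> invariant_measure G act M \<and> nontrivial_measure X M)"
  shows "almost_unperforated G X act \<longleftrightarrow> paradoxical_comparison G X act"
proof -
  obtain \<B> where \<B>: "countable \<B>" "clopen_base X \<B>"
    using homeomorphic_clopen_base[OF assms(4)] cantor_space_clopen_base by blast
  have "compact_space X"
    using homeomorphic_compact_space[OF assms(4)] compact_cantor_space by simp
  then interpret compact_zero_dim_action G X act \<B>
    using assms(5) \<B> by unfold_locales
  show ?thesis
    using almost_unperforated_imp_paradoxical[OF _ assms(6)] paradoxical_imp_almost_unperforated by blast
qed

end
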